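(* Let $n_1,\ldots,n_F$ be positive integers (block sizes) with $\sum_{j=1}^F n_j = n$, and let $\mathbf{\Delta} = \{\mathrm{diag}(\Delta_1,\ldots,\Delta_F) : \Delta_j \in \mathbb{C}^{n_j\times n_j}\}$ be the associated set of block-diagonal matrices with $F$ full complex blocks. If $M \in \mathbb{R}^{n\times n}$ and $F \le 5$, then $\mu_{\mathbf{\Delta}}(M) = \nu_{\mathbf{\Delta}}(M)$.
   Context: For a matrix $A$, $\overline{\sigma}(A)$ denotes its largest singular value. Let $n_1,\ldots,n_F$ be positive integers with $\sum_{j=1}^F n_j = n$ and $\mathbf{\Delta} = \{\mathrm{diag}(\Delta_1,\ldots,\Delta_F) : \Delta_j \in \mathbb{C}^{n_j\times n_j}\}$, where $\mathrm{diag}$ denotes the block-diagonal matrix with the given diagonal blocks. The structured singular value of $M \in \mathbb{C}^{n\times n}$ with respect to $\mathbf{\Delta}$ is $$\mu_{\mathbf{\Delta}}(M) := \frac{1}{\min\{\overline{\sigma}(\Delta) : \Delta \in \mathbf{\Delta},\ \det(I - M\Delta) = 0\}},$$ unless $\det(I - M\Delta) \ne 0$ for all $\Delta \in \mathbf{\Delta}$, in which case $\mu_{\mathbf{\Delta}}(M) := 0$. The perturbations $\Delta$ are complex even when $M$ is real. The convex upper bound is $$\nu_{\mathbf{\Delta}}(M) := \inf_{D \in \mathbf{D}} \overline{\sigma}(D^{1/2} M D^{-1/2}),$$ where $\mathbf{D} = \{\mathrm{diag}(d_1 I_{n_1},\ldots,d_F I_{n_F}) : d_j \in \mathbb{R},\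 d_j > 0\}$ and $I_k$ is the $k\times k$ identity matrix. *)

theory Defs
  imports Complex_Main "Jordan_Normal_Form.Schur_Decomposition"
begin

definition singular_values :: "complex mat \<Rightarrow> real set" where
  "singular_values A =
     {s. 0 \<le> s \<and> eigenvalue (mat_adjoint A * A) (complex_of_real (s\<^sup>2))}"

(* Meaningful for matrices with at least one column; for others the set is empty. *)
definition max_singular_value :: "complex mat \<Rightarrow> real" where
  "max_singular_value A = Max (singular_values A)"

(* Block sizes are given as the list [n_1, ..., n_F]. *)
definition block_diagonals :: "nat list \<Rightarrow> complex mat set" where
  "block_diagonals ns =
     {diag_block_mat As | As. list_all2 (\<lambda>A k. A \<in> carrier_mat k k) As ns}"

(* LEAST on the reals denotes an attained minimum and is unspecified if there is none,
   so reading it as "min" does not rely on replacing the minimum by an infimum. *)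
definition structured_singular_value :: "complex mat set \<Rightarrow> complex mat \<Rightarrow> real" where
  "structured_singular_value \<Delta>s M =
     (if \<forall>\<Delta>\<in>\<Delta>s. det (1\<^sub>m (dim_row M) - M * \<Delta>) \<noteq> 0 then 0
      else 1 / (LEAST r. r \<in> {max_singular_value \<Delta> | \<Delta>.
                              \<Delta> \<in> \<Delta>s \<and> det (1\<^sub>m (dim_row M) - M * \<Delta>) = 0}))"

definition block_scalings :: "nat list \<Rightarrow> real mat set" where
  "block_scalings ns =
     {diag_block_mat (map2 (\<lambda>d k. d \<cdot>\<^sub>m 1\<^sub>m k) ds ns) | ds.
        length ds = length ns \<and> (\<forall>d\<in>set ds. 0 < d)}"

(* Real power of a diagonal matrix with positive diagonal, taken entrywise on the diagonal. *)
definition diag_powr :: "real mat \<Rightarrow> real \<Rightarrow> real mat" where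
  "diag_powr D p = mat_diag (dim_row D) (\<lambda>i. D $$ (i, i) powr p)"

definition convex_upper_bound :: "nat list \<Rightarrow> complex mat \<Rightarrow> real" where
  "convex_upper_bound ns M =
     (INF D\<in>block_scalings ns.
        max_singular_value (map_mat complex_of_real (diag_powr D (1 / 2)) * M *
                            map_mat complex_of_real (diag_powr D (- 1 / 2))))"

end

(* For c >= 0 let G(c) say that some x <> 0 satisfies |(Mx)_j| >= c |x_j| for every block j.  A singular
   perturbation Delta gives G(1/sigma(Delta)) (take x = Delta w with M Delta w = w), and conversely
   G(c) with c > 0 gives a singular perturbation of norm at most 1/c built from the rank one blocks
   x_j (Mx)_j^* / |(Mx)_j|^2.  Clearly G(c) forces c <= nu.  So everything reduces to G(nu).

   With the real quadratic forms H_j = M^T P_j M - nu^2 P_j, the bound nu says that no positive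
   combination of the H_j is negative definite, so by separation the convex hull of their joint range on
   the unit sphere meets the nonnegative orthant: some real positive semidefinite X of trace 1 has
   tr(H_j X) >= 0 for all j.  Since M is real, a complex x = f + ig contributes X = f f^T + g g^T, so
   it suffices to find such an X of rank at most two.  Choose X maximising min_j tr(H_j X) and then
   of least rank, X = V V^T.  If the rank is at least 3, perturb three columns of V, replacing their
   contribution W W^T by W (I + tS) W^T with S symmetric 3x3.  Keeping the trace and changing all tr(H_j X)
   by the same amount ct imposes at most 6 linear conditions on the 7 unknowns (S, c).  A nonzero
   solution either increases the minimum (c <> 0) or can be followed until the rank drops (c = 0). *)

theory Submission
  imports "HOL-Analysis.Analysis" Defs
begin

unbundle no vec_syntax
no_notation scalar_prod (infix \<open>\<bullet>\<close> 70)

subsection \<open>Ternary quadratic forms\<close>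

text \<open>Near 0 the linear term dominates, so a nonzero \<open>b\<close> would give a negative
  value at a small \<open>t\<close> of opposite sign. This is the first order condition at a zero of
  a nonnegative form.\<close>

lemma psd_form_gradient_zero:
  fixes b g :: real
  assumes "\<And>t. 0 \<le> b * t + g * t\<^sup>2"
  shows "b = 0"
proof (rule ccontr)
  assume "b \<noteq> 0"
  \<comment> \<open>With this choice \<open>b * t\<close> equals -(|g| + 1) t^2, which outweighs
    \<open>g * t\<^sup>2\<close> whatever the sign of \<open>g\<close>.\<close>
  define t where "t = - b / (\<bar>g\<bar> + 1)"
  have pos: "\<bar>g\<bar> + 1 > 0" by linarith
  have bt: "b = - t * (\<bar>g\<bar> + 1)" using pos by (simp add: t_def)
  have t: "t\<^sup>2 > 0" using \<open>b \<noteq> 0\<close> bt by auto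
  have "b * t + g * t\<^sup>2 = - t\<^sup>2 * (\<bar>g\<bar> + 1 - g)" by (simp add: bt power2_eq_square algebra_simps)
  also have "\<dots> < 0" using t mult_pos_pos[OF t, of "\<bar>g\<bar> + 1 - g"] by auto
  finally show False using assms[of t] by linarith
qed

text \<open>The form of the symmetric matrix with diagonal \<open>p\<close>, \<open>q\<close>,
  \<open>r\<close> and entries \<open>s / 2\<close>, \<open>t / 2\<close>, \<open>u / 2\<close> in
  positions (2,3), (1,3), (1,2).\<close>

definition ternary_form :: "real \<Rightarrow> real \<Rightarrow> real \<Rightarrow> real \<Rightarrow> real \<Rightarrow> real \<Rightarrow> real \<Rightarrow> real \<Rightarrow> real \<Rightarrow> real" where
  "ternary_form p q r s t u x y z = p * x\<^sup>2 + q * y\<^sup>2 + r * z\<^sup>2 + s * (y * z) + t * (x * z) + u * (x * y)"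

text \<open>Taylor expansion along a line: the coefficient of \<open>k\<close> is the gradient at
  \<open>(x, y, z)\<close> paired with the direction \<open>(x', y', z')\<close>.\<close>

lemma ternary_form_shift:
  "ternary_form p q r s t u (x + k * x') (y + k * y') (z + k * z') =
   ternary_form p q r s t u x y z
   + (x' * (2 * p * x + u * y + t * z) + y' * (2 * q * y + u * x + s * z) + z' * (2 * r * z + t * x + s * y)) * k
   + ternary_form p q r s t u x' y' z' * k\<^sup>2"
  by (simp add: ternary_form_def power2_eq_square algebra_simps)

text \<open>Completing the square (a Cholesky factorisation). If \<open>p = 0\<close>, the first
  order condition forces \<open>u = 0\<close>.\<close>

lemma binary_psd_sum_of_squares:
  fixes p q u :: real
  assumes psd: "\<And>x y. 0 \<le> p * x\<^sup>2 + q * y\<^sup>2 + u * (x * y)"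
  shows "\<exists>\<alpha> \<beta> \<delta>. p = \<alpha>\<^sup>2 \<and> q = \<beta>\<^sup>2 + \<delta>\<^sup>2 \<and> u = 2 * \<alpha> * \<beta>"
proof -
  have p: "p \<ge> 0" using psd[of 1 0] by simp
  have q: "q \<ge> 0" using psd[of 0 1] by simp
  show ?thesis
  proof (cases "p = 0")
    case True
    have "u = 0" using psd_form_gradient_zero[of u q] psd[of 1] True by (simp add: algebra_simps)
    then show ?thesis using True q by - (rule exI[of _ 0], rule exI[of _ 0], rule exI[of _ "sqrt q"], simp)
  next
    case False
    with p have p0: "p > 0" by simp
    \<comment> \<open>For \<open>y = -1\<close> this \<open>x\<close> minimises the form, and the
      minimum is the Schur complement of \<open>p\<close>.\<close>
    have "0 \<le> p * (u / (2 * p))\<^sup>2 + q * (-1)\<^sup>2 + u * (u / (2 * p) * (-1))" by (rule psd)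
    also have "\<dots> = q - u\<^sup>2 / (4 * p)" using p0 by (simp add: power2_eq_square field_simps)
    finally have d: "0 \<le> q - u\<^sup>2 / (4 * p)" .
    show ?thesis
      using p0 d
      by - (rule exI[of _ "sqrt p"], rule exI[of _ "u / (2 * sqrt p)"], rule exI[of _ "sqrt (q - u\<^sup>2 / (4 * p))"],
            simp add: power_divide power_mult_distrib)
  qed
qed

text \<open>A zero of a semidefinite form lies in the kernel of its matrix. Scaled to
  \<open>(x, y, 1)\<close>, the kernel vector makes the form at (X, Y, Z) equal to its value at (X -
  xZ, Y - yZ, 0), so a binary factorisation provides the two squares.\<close>

lemma ternary_psd_sum_of_squares_aux:
  assumes psd: "\<And>x y z. 0 \<le> ternary_form p q r s t u x y z"
    and zero: "ternary_form p q r s t u x0 y0 z0 = 0" and z0: "z0 \<noteq> 0"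
  shows "\<exists>a1 a2 a3 b1 b2 b3. p = a1\<^sup>2 + b1\<^sup>2 \<and> q = a2\<^sup>2 + b2\<^sup>2 \<and> r = a3\<^sup>2 + b3\<^sup>2 \<and>
           s = 2 * (a2 * a3 + b2 * b3) \<and> t = 2 * (a1 * a3 + b1 * b3) \<and> u = 2 * (a1 * a2 + b1 * b2)"
proof -
  define x where "x = x0 / z0"
  define y where "y = y0 / z0"
  have z: "ternary_form p q r s t u x y 1 = 0"
  proof -
    have "ternary_form p q r s t u x y 1 = ternary_form p q r s t u x0 y0 z0 / z0\<^sup>2"
      using z0 by (simp add: ternary_form_def x_def y_def power2_eq_square field_simps)
    then show ?thesis using zero by simp
  qed
  have grad: "x' * (2 * p * x + u * y + t) + y' * (2 * q * y + u * x + s) + z' * (2 * r + t * x + s * y) = 0"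
    for x' y' z'
    using psd[of "x + k * x'" "y + k * y'" "1 + k * z'" for k]
    by (intro psd_form_gradient_zero[of _ "ternary_form p q r s t u x' y' z'"])
       (simp add: ternary_form_shift z)
  \<comment> \<open>The three unit directions give the three rows of the kernel equation, which
    determine the last row of the matrix from \<open>p\<close>, \<open>q\<close>,
    \<open>u\<close>.\<close>
  have t: "t = - (2 * p * x + u * y)" and s: "s = - (2 * q * y + u * x)" and r: "2 * r = - (t * x + s * y)"
    using grad[of 1 0 0] grad[of 0 1 0] grad[of 0 0 1] by auto
  obtain \<alpha> \<beta> \<delta> where d: "p = \<alpha>\<^sup>2" "q = \<beta>\<^sup>2 + \<delta>\<^sup>2" "u = 2 * \<alpha> * \<beta>"
    using binary_psd_sum_of_squares[of p q u] psd[of _ _ 0] by (auto simp: ternary_form_def)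
  have r': "r = (\<alpha> * x + \<beta> * y)\<^sup>2 + (\<delta> * y)\<^sup>2"
    using r unfolding s t d by (simp add: power2_eq_square algebra_simps)
  show ?thesis
    by (rule exI[of _ \<alpha>], rule exI[of _ \<beta>], rule exI[of _ "- (\<alpha> * x + \<beta> * y)"],
        rule exI[of _ 0], rule exI[of _ \<delta>], rule exI[of _ "- \<delta> * y"])
       (simp add: r' s t d power2_eq_square algebra_simps)
qed

text \<open>Some coordinate of the zero is nonzero; exchanging variables, and the coefficients
  accordingly, makes it the last one.\<close>

lemma ternary_psd_sum_of_squares:
  assumes psd: "\<And>x y z. 0 \<le> ternary_form p q r s t u x y z"
    and zero: "ternary_form p q r s t u x0 y0 z0 = 0" and nz: "(x0, y0, z0) \<noteq> (0, 0, 0)"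
  shows "\<exists>a1 a2 a3 b1 b2 b3. p = a1\<^sup>2 + b1\<^sup>2 \<and> q = a2\<^sup>2 + b2\<^sup>2 \<and> r = a3\<^sup>2 + b3\<^sup>2 \<and>
           s = 2 * (a2 * a3 + b2 * b3) \<and> t = 2 * (a1 * a3 + b1 * b3) \<and> u = 2 * (a1 * a2 + b1 * b2)"
proof -
  have xz: "ternary_form r q p u t s z y x = ternary_form p q r s t u x y z" for x y z
    by (simp add: ternary_form_def algebra_simps)
  have yz: "ternary_form p r q s u t x z y = ternary_form p q r s t u x y z" for x y z
    by (simp add: ternary_form_def algebra_simps)
  consider "z0 \<noteq> 0" | "y0 \<noteq> 0" | "x0 \<noteq> 0" using nz by auto
  then show ?thesis
  proof cases
    case 1
    then show ?thesis using ternary_psd_sum_of_squares_aux[OF psd zero] by blast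
  next
    case 2
    have "\<exists>a1 a2 a3 b1 b2 b3. p = a1\<^sup>2 + b1\<^sup>2 \<and> r = a2\<^sup>2 + b2\<^sup>2 \<and> q = a3\<^sup>2 + b3\<^sup>2 \<and>
           s = 2 * (a2 * a3 + b2 * b3) \<and> u = 2 * (a1 * a3 + b1 * b3) \<and> t = 2 * (a1 * a2 + b1 * b2)"
      by (rule ternary_psd_sum_of_squares_aux[of _ _ _ _ _ _ x0 z0 y0]) (auto simp: yz psd zero 2)
    then obtain a1 a2 a3 b1 b2 b3 where "p = a1\<^sup>2 + b1\<^sup>2" "r = a2\<^sup>2 + b2\<^sup>2" "q = a3\<^sup>2 + b3\<^sup>2"
           "s = 2 * (a2 * a3 + b2 * b3)" "u = 2 * (a1 * a3 + b1 * b3)" "t = 2 * (a1 * a2 + b1 * b2)" by blast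
    then show ?thesis
      by - (rule exI[of _ a1], rule exI[of _ a3], rule exI[of _ a2], rule exI[of _ b1], rule exI[of _ b3], rule exI[of _ b2],
            simp add: mult.commute)
  next
    case 3
    have "\<exists>a1 a2 a3 b1 b2 b3. r = a1\<^sup>2 + b1\<^sup>2 \<and> q = a2\<^sup>2 + b2\<^sup>2 \<and> p = a3\<^sup>2 + b3\<^sup>2 \<and>
           u = 2 * (a2 * a3 + b2 * b3) \<and> t = 2 * (a1 * a3 + b1 * b3) \<and> s = 2 * (a1 * a2 + b1 * b2)"
      by (rule ternary_psd_sum_of_squares_aux[of _ _ _ _ _ _ z0 y0 x0]) (auto simp: xz psd zero 3)
    then obtain a1 a2 a3 b1 b2 b3 where "r = a1\<^sup>2 + b1\<^sup>2" "q = a2\<^sup>2 + b2\<^sup>2" "p = a3\<^sup>2 + b3\<^sup>2"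
           "u = 2 * (a2 * a3 + b2 * b3)" "t = 2 * (a1 * a3 + b1 * b3)" "s = 2 * (a1 * a2 + b1 * b2)" by blast
    then show ?thesis
      by - (rule exI[of _ a3], rule exI[of _ a2], rule exI[of _ a1], rule exI[of _ b3], rule exI[of _ b2], rule exI[of _ b1],
            simp add: mult.commute)
  qed
qed

text \<open>The minimum \<open>m\<close> over the compact unit sphere is attained, and homogeneity
  carries the bound to all vectors; \<open>m\<close> is the least eigenvalue.\<close>

lemma ternary_form_min:
  obtains m x0 y0 z0 where "\<And>x y z. m * (x\<^sup>2 + y\<^sup>2 + z\<^sup>2) \<le> ternary_form p q r s t u x y z"
    and "ternary_form p q r s t u x0 y0 z0 = m" and "x0\<^sup>2 + y0\<^sup>2 + z0\<^sup>2 = 1"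
proof -
  define f where "f = (\<lambda>(x, y, z). ternary_form p q r s t u x y z)"
  let ?S = "sphere (0 :: real \<times> real \<times> real) 1"
  have nrm: "norm (x, y, z) = sqrt (x\<^sup>2 + y\<^sup>2 + z\<^sup>2)" for x y z :: real
    by (simp add: norm_Pair add.assoc)
  have "continuous_on ?S f"
    unfolding f_def ternary_form_def split_def by (intro continuous_intros)
  moreover have "(1, 0, 0) \<in> ?S" by (simp add: norm_Pair)
  then have "?S \<noteq> {}" by blast
  ultimately obtain w where w: "w \<in> ?S" "\<And>v. v \<in> ?S \<Longrightarrow> f w \<le> f v"
    using continuous_attains_inf[of ?S f] compact_sphere by blast
  obtain x0 y0 z0 where w0: "w = (x0, y0, z0)" by (cases w) auto
  show thesis
  proof
    show "ternary_form p q r s t u x0 y0 z0 = f w" by (simp add: f_def w0)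
    show "x0\<^sup>2 + y0\<^sup>2 + z0\<^sup>2 = 1" using w(1) by (simp add: w0 nrm)
    fix x y z :: real
    define k where "k = norm (x, y, z)"
    have k2: "k\<^sup>2 = x\<^sup>2 + y\<^sup>2 + z\<^sup>2" by (simp add: k_def nrm)
    show "f w * (x\<^sup>2 + y\<^sup>2 + z\<^sup>2) \<le> ternary_form p q r s t u x y z"
    proof (cases "k = 0")
      case True
      then have "x = 0" "y = 0" "z = 0" by (auto simp: k_def zero_prod_def)
      then show ?thesis by (simp add: ternary_form_def)
    next
      case False
      have "(x / k)\<^sup>2 + (y / k)\<^sup>2 + (z / k)\<^sup>2 = k\<^sup>2 / k\<^sup>2"
        by (simp only: power_divide add_divide_distrib[symmetric] k2)
      then have "norm (x / k, y / k, z / k) = 1" using False by (simp add: nrm)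
      then have "f w \<le> f (x / k, y / k, z / k)" by (intro w) simp
      also have "\<dots> = ternary_form p q r s t u x y z / k\<^sup>2"
        using False by (simp add: f_def ternary_form_def power2_eq_square field_simps)
      finally show ?thesis using False by (simp add: k2[symmetric] pos_le_divide_eq)
    qed
  qed
qed

(* Subtracting the least eigenvalue m leaves a singular semidefinite form, that is, one of rank at most two. *)
lemma ternary_decomposition:
  obtains m a1 a2 a3 b1 b2 b3 :: real where
    "p = m + a1\<^sup>2 + b1\<^sup>2" "q = m + a2\<^sup>2 + b2\<^sup>2" "r = m + a3\<^sup>2 + b3\<^sup>2"
    "s = 2 * (a2 * a3 + b2 * b3)" "t = 2 * (a1 * a3 + b1 * b3)" "u = 2 * (a1 * a2 + b1 * b2)"
proof -
  obtain m x0 y0 z0 where m: "\<And>x y z. m * (x\<^sup>2 + y\<^sup>2 + z\<^sup>2) \<le> ternary_form p q r s t u x y z"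
    "ternary_form p q r s t u x0 y0 z0 = m" "x0\<^sup>2 + y0\<^sup>2 + z0\<^sup>2 = 1"
    by (rule ternary_form_min[of p q r s t u]) blast
  have sh: "ternary_form (p - m) (q - m) (r - m) s t u x y z
              = ternary_form p q r s t u x y z - m * (x\<^sup>2 + y\<^sup>2 + z\<^sup>2)" for x y z
    by (simp add: ternary_form_def algebra_simps)
  have "\<exists>a1 a2 a3 b1 b2 b3. p - m = a1\<^sup>2 + b1\<^sup>2 \<and> q - m = a2\<^sup>2 + b2\<^sup>2 \<and> r - m = a3\<^sup>2 + b3\<^sup>2 \<and>
           s = 2 * (a2 * a3 + b2 * b3) \<and> t = 2 * (a1 * a3 + b1 * b3) \<and> u = 2 * (a1 * a2 + b1 * b2)"
    using m by (intro ternary_psd_sum_of_squares[of _ _ _ _ _ _ x0 y0 z0]) (auto simp: sh)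
  then obtain a1 a2 a3 b1 b2 b3 where "p - m = a1\<^sup>2 + b1\<^sup>2" "q - m = a2\<^sup>2 + b2\<^sup>2" "r - m = a3\<^sup>2 + b3\<^sup>2"
           "s = 2 * (a2 * a3 + b2 * b3)" "t = 2 * (a1 * a3 + b1 * b3)" "u = 2 * (a1 * a2 + b1 * b2)"
    by blast
  then show thesis by (intro that[of m a1 b1 a2 b2 a3 b3]) auto
qed

subsection \<open>Joint ranges of real quadratic forms\<close>

text \<open>Vectors are total functions of which only the coordinates below \<open>n\<close> count,
  so the dimension stays a number and the product topology on functions is available.\<close>

definition qform :: "nat \<Rightarrow> (nat \<Rightarrow> nat \<Rightarrow> real) \<Rightarrow> (nat \<Rightarrow> real) \<Rightarrow> real" where
  "qform n A f = (\<Sum>i<n. \<Sum>k<n. A i k * f i * f k)"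

text \<open>The mixed term of \<open>qform\<close> on a sum of two vectors, hence twice the bilinear
  form when \<open>A\<close> is symmetric.\<close>

definition polar :: "nat \<Rightarrow> (nat \<Rightarrow> nat \<Rightarrow> real) \<Rightarrow> (nat \<Rightarrow> real) \<Rightarrow> (nat \<Rightarrow> real) \<Rightarrow> real" where
  "polar n A f g = (\<Sum>i<n. \<Sum>k<n. A i k * (f i * g k + g i * f k))"

text \<open>The identity matrix; with it the squared norm, and so the trace of a sum of rank one
  matrices, is a value of \<open>qform\<close> like the other constraints.\<close>

definition delta :: "nat \<Rightarrow> nat \<Rightarrow> real" where
  "delta i k = (if i = k then 1 else 0)"

lemma qform_delta: "qform n delta f = (\<Sum>i<n. (f i)\<^sup>2)"
proof -
  have "qform n delta f = (\<Sum>i<n. \<Sum>k<n. if i = k then (f i)\<^sup>2 else 0)"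
    unfolding qform_def delta_def by (intro sum.cong) (auto simp: power2_eq_square)
  also have "\<dots> = (\<Sum>i<n. (f i)\<^sup>2)" by (intro sum.cong) auto
  finally show ?thesis .
qed

lemma qform_delta_nonneg: "0 \<le> qform n delta f"
  by (simp add: qform_delta sum_nonneg)

lemma qform_delta_zero_iff: "qform n delta f = 0 \<longleftrightarrow> (\<forall>i<n. f i = 0)"
  by (auto simp: qform_delta sum_nonneg_eq_0_iff)

lemma qform_scale: "qform n A (\<lambda>i. c * f i) = c\<^sup>2 * qform n A f"
  unfolding qform_def sum_distrib_left by (intro sum.cong refl) (simp add: power2_eq_square algebra_simps)

text \<open>Restricting a form to the span of three vectors gives a ternary form, to which the
  decomposition above applies.\<close>

lemma qform_comb:
  "qform n A (\<lambda>i. a * f i + b * g i + c * h i) =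
    ternary_form (qform n A f) (qform n A g) (qform n A h) (polar n A g h) (polar n A f h) (polar n A f g) a b c"
  unfolding qform_def polar_def ternary_form_def sum_distrib_left sum_distrib_right sum.distrib[symmetric]
  by (intro sum.cong refl) (simp add: power2_eq_square algebra_simps)

text \<open>The rank reduction step, with semidefinite matrices written as sums of x x^T over lists
  of vectors. In the first alternative the list may become longer, but every form strictly
  increases; in the second, two vectors replace three without changing any value.\<close>

lemma three_vectors_reducible:
  fixes u v w :: "nat \<Rightarrow> real"
  assumes dim: "DIM('e::euclidean_space) \<le> 5"
  shows "(\<exists>xs. (\<Sum>x\<leftarrow>xs. qform n delta x) = qform n delta u + qform n delta v + qform n delta w \<and>
            (\<forall>b\<in>Basis :: 'e set. (\<Sum>x\<leftarrow>xs. qform n (A b) x) > qform n (A b) u + qform n (A b) v + qform n (A b) w)) \<or>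
         (\<exists>x y. qform n delta x + qform n delta y = qform n delta u + qform n delta v + qform n delta w \<and>
            (\<forall>b\<in>Basis :: 'e set. qform n (A b) x + qform n (A b) y = qform n (A b) u + qform n (A b) v + qform n (A b) w))"
proof -
  (* For S encoded as (p, q, r, s, t, l), this is the trace of C W S W^T, where W has the columns u, v, w
     and S has diagonal p, q, r and off-diagonal entries s/2, t/2, l/2. *)
  define \<Phi> where "\<Phi> = (\<lambda>C (p, q, r, s, t, l).
      p * qform n C u + q * qform n C v + r * qform n C w +
      (s * polar n C v w + t * polar n C u w + l * polar n C u v) / 2)"
  have \<Phi>: "\<Phi> C (p, q, r, s, t, l) = p * qform n C u + q * qform n C v + r * qform n C w +
      (s * polar n C v w + t * polar n C u w + l * polar n C u v) / 2" for C p q r s t l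
    by (simp add: \<Phi>_def)
  have \<Phi>_linear: "linear (\<Phi> C)" for C
    by (rule linearI) (auto simp: \<Phi> scaleR_prod_def field_simps)
  \<comment> \<open>The kernel of \<open>T\<close> consists of the pairs \<open>(S, c)\<close> for
    which the perturbation \<open>S\<close> keeps the trace and changes every form at the same rate
    \<open>c\<close>.\<close>
  define T :: "(real \<times> real \<times> real \<times> real \<times> real \<times> real) \<times> real \<Rightarrow> real \<times> 'e" where
    "T = (\<lambda>z. (\<Phi> delta (fst z), (\<Sum>b\<in>Basis. (\<Phi> (A b) (fst z) - snd z) *\<^sub>R b)))"
  have "linear T"
    by (rule linearI)
       (simp_all add: T_def linear_add[OF \<Phi>_linear] linear_cmul[OF \<Phi>_linear] algebra_simps
             sum.distrib scaleR_sum_right sum_subtractf)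
  \<comment> \<open>The domain has dimension 7, the codomain at most 1 + 5.\<close>
  moreover have "\<not> inj T"
  proof
    assume "inj T"
    then have "dim (range T) = dim (UNIV :: ((real \<times> real \<times> real \<times> real \<times> real \<times> real) \<times> real) set)"
      using \<open>linear T\<close> by (intro dim_image_eq) auto
    moreover have "dim (range T) \<le> DIM(real \<times> 'e)" by (rule dim_subset_UNIV)
    ultimately show False using dim by simp
  qed
  ultimately obtain Sc where "T Sc = 0" "Sc \<noteq> 0"
    by (auto simp: linear_injective_0)
  then obtain S c where Tz: "T (S, c) = 0" and nz: "(S, c) \<noteq> 0" by (cases Sc) auto
  have \<Phi>N: "\<Phi> delta S = 0" using Tz by (simp add: T_def zero_prod_def)
  have \<Phi>A: "\<Phi> (A b) S = c" if "b \<in> Basis" for b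
  proof -
    have "0 = (\<Sum>b\<in>Basis. (\<Phi> (A b) S - c) *\<^sub>R b) \<bullet> b" using Tz by (simp add: T_def zero_prod_def)
    also have "\<dots> = \<Phi> (A b) S - c" using that by simp
    finally show ?thesis by simp
  qed
  define L where "L = (\<lambda>a b c i. a * u i + b * v i + c * w i)"
  \<comment> \<open>Stated for arbitrary coefficients because it is applied either to
    \<open>S\<close> or to its negative. The decomposition reads S = m I + a a^T + b b^T.\<close>
  have key: ?thesis
    if N: "\<Phi> delta (p, q, r, s, t, l) = 0" and Q: "\<And>b. b \<in> Basis \<Longrightarrow> \<Phi> (A b) (p, q, r, s, t, l) = c"
      and dec: "p = m + a1\<^sup>2 + b1\<^sup>2" "q = m + a2\<^sup>2 + b2\<^sup>2" "r = m + a3\<^sup>2 + b3\<^sup>2"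
        "s = 2 * (a2 * a3 + b2 * b3)" "t = 2 * (a1 * a3 + b1 * b3)" "l = 2 * (a1 * a2 + b1 * b2)"
      and c: "c > 0 \<or> c = 0 \<and> m < 0"
    for p q r s t l c m a1 a2 a3 b1 b2 b3
  proof -
    have dec\<Phi>: "\<Phi> C (p, q, r, s, t, l) = m * (qform n C u + qform n C v + qform n C w)
        + qform n C (L a1 a2 a3) + qform n C (L b1 b2 b3)" for C
      unfolding \<Phi> L_def qform_comb dec by (simp add: ternary_form_def field_simps)
    show ?thesis
      using c
    proof
      assume "c > 0"
      \<comment> \<open>Small enough that 1 + \<epsilon> m is nonnegative. Then W (I + \<epsilon> S)
        W^T is a sum of five rank one terms, and each form gains \<epsilon> c.\<close>
      define \<epsilon> where "\<epsilon> = 1 / (1 + \<bar>m\<bar>)"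
      have \<epsilon>: "\<epsilon> > 0" by (simp add: \<epsilon>_def add_pos_nonneg)
      have m1: "1 + \<epsilon> * m \<ge> 0" by (simp add: \<epsilon>_def field_simps)
      define xs where "xs = [\<lambda>i. sqrt (1 + \<epsilon> * m) * u i, \<lambda>i. sqrt (1 + \<epsilon> * m) * v i, \<lambda>i. sqrt (1 + \<epsilon> * m) * w i,
          \<lambda>i. sqrt \<epsilon> * L a1 a2 a3 i, \<lambda>i. sqrt \<epsilon> * L b1 b2 b3 i]"
      have xs: "(\<Sum>x\<leftarrow>xs. qform n C x) = qform n C u + qform n C v + qform n C w + \<epsilon> * \<Phi> C (p, q, r, s, t, l)" for C
        using m1 \<epsilon> by (simp add: xs_def qform_scale dec\<Phi>) (simp add: algebra_simps)
      show ?thesis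
        using N Q \<epsilon> \<open>c > 0\<close> by (intro disjI1 exI[of _ xs]) (simp add: xs)
    next
      assume c: "c = 0 \<and> m < 0"
      \<comment> \<open>The step length -1/m is where the multiple of the identity in I + tS
        cancels, leaving -(a a^T + b b^T)/m, of rank at most two.\<close>
      define x where "x = (\<lambda>i. sqrt (- 1 / m) * L a1 a2 a3 i)"
      define y where "y = (\<lambda>i. sqrt (- 1 / m) * L b1 b2 b3 i)"
      have xy: "qform n C x + qform n C y = qform n C u + qform n C v + qform n C w" if "\<Phi> C (p, q, r, s, t, l) = 0" for C
      proof -
        have "qform n C x + qform n C y = - (qform n C (L a1 a2 a3) + qform n C (L b1 b2 b3)) / m"
          using c unfolding x_def y_def qform_scale by (simp add: field_simps)
        also have "\<dots> = qform n C u + qform n C v + qform n C w"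
          using that c unfolding dec\<Phi> by (simp add: field_simps)
        finally show ?thesis .
      qed
      show ?thesis
        using N Q c by (intro disjI2 exI[of _ x] exI[of _ y]) (simp add: xy)
    qed
  qed
  obtain p q r s t l where S: "S = (p, q, r, s, t, l)" by (cases S) auto
  have neg: "\<Phi> C (- p, - q, - r, - s, - t, - l) = - \<Phi> C S" for C
    by (simp add: \<Phi> S field_simps)
  obtain m a1 a2 a3 b1 b2 b3 where dec:
    "p = m + a1\<^sup>2 + b1\<^sup>2" "q = m + a2\<^sup>2 + b2\<^sup>2" "r = m + a3\<^sup>2 + b3\<^sup>2"
    "s = 2 * (a2 * a3 + b2 * b3)" "t = 2 * (a1 * a3 + b1 * b3)" "l = 2 * (a1 * a2 + b1 * b2)"
    by (rule ternary_decomposition)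
  obtain m' a1' a2' a3' b1' b2' b3' where dec':
    "- p = m' + a1'\<^sup>2 + b1'\<^sup>2" "- q = m' + a2'\<^sup>2 + b2'\<^sup>2" "- r = m' + a3'\<^sup>2 + b3'\<^sup>2"
    "- s = 2 * (a2' * a3' + b2' * b3')" "- t = 2 * (a1' * a3' + b1' * b3')" "- l = 2 * (a1' * a2' + b1' * b2')"
    by (rule ternary_decomposition)
  \<comment> \<open>If neither \<open>S\<close> nor its negative can be used, then
    \<open>c = 0\<close> and both are positive semidefinite. Hence \<open>S\<close> vanishes,
    against the choice of a nonzero kernel element.\<close>
  consider "c > 0 \<or> c = 0 \<and> m < 0" | "- c > 0 \<or> - c = 0 \<and> m' < 0" | "c = 0" "m \<ge> 0" "m' \<ge> 0"
    by linarith
  then show ?thesis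
  proof cases
    case 1
    show ?thesis using \<Phi>N \<Phi>A by (intro key[OF _ _ dec 1]) (auto simp: S)
  next
    case 2
    show ?thesis using \<Phi>N \<Phi>A by (intro key[OF _ _ dec' 2]) (auto simp: neg)
  next
    case 3
    have "p = 0" "q = 0" "r = 0" "m = 0"
      using dec(1-3) dec'(1-3) 3 by (smt (verit) zero_le_power2)+
    moreover from this have "a1 = 0" "a2 = 0" "a3 = 0" "b1 = 0" "b2 = 0" "b3 = 0"
      using dec(1-3) by (auto simp: sum_power2_eq_zero_iff)
    ultimately have "(S, c) = 0" using dec 3 by (simp add: S zero_prod_def)
    with nz show ?thesis by blast
  qed
qed

section \<open>Compactness and convex hull of the joint range\<close>

lemma continuous_on_Min_image:
  fixes f :: "'i \<Rightarrow> 'a::topological_space \<Rightarrow> real"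
  assumes "finite I" "I \<noteq> {}" "\<And>i. i \<in> I \<Longrightarrow> continuous_on S (f i)"
  shows "continuous_on S (\<lambda>x. Min ((\<lambda>i. f i x) ` I))"
  using assms
proof (induction I rule: finite_ne_induct)
  case (insert i F)
  then have "(\<lambda>x. Min ((\<lambda>i. f i x) ` insert i F)) = (\<lambda>x. min (f i x) (Min ((\<lambda>i. f i x) ` F)))"
    by (simp add: Min_insert)
  then show ?case using insert by (auto intro: continuous_intros)
qed simp

text \<open>A closed subset of a product of unit balls, which is compact by Tychonoff. The bound on
  every single coordinate matters because the sum does not control those from \<open>n\<close>
  on.\<close>

lemma compact_unit_sphere_coordinates:
  "compact {f :: nat \<Rightarrow> 'a::euclidean_space. (\<forall>i. norm (f i) \<le> 1) \<and> (\<Sum>i<n. (norm (f i))\<^sup>2) = 1}"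
proof -
  have "compactin (product_topology (\<lambda>i. euclidean) UNIV) (PiE UNIV (\<lambda>i::nat. cball (0::'a) 1))"
    by (auto simp: compactin_PiE)
  then have "compact (PiE UNIV (\<lambda>i::nat. cball (0::'a) 1))"
    by (simp add: euclidean_product_topology)
  moreover have "closed {f :: nat \<Rightarrow> 'a. (\<Sum>i<n. (norm (f i))\<^sup>2) = 1}"
    by (intro closed_Collect_eq continuous_intros continuous_on_product_then_coordinatewise continuous_on_id)
  ultimately have "compact (PiE UNIV (\<lambda>i::nat. cball (0::'a) 1) \<inter> {f. (\<Sum>i<n. (norm (f i))\<^sup>2) = 1})"
    by (rule compact_Int_closed)
  also have "PiE UNIV (\<lambda>i::nat. cball (0::'a) 1) \<inter> {f. (\<Sum>i<n. (norm (f i))\<^sup>2) = 1} =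
      {f. (\<forall>i. norm (f i) \<le> 1) \<and> (\<Sum>i<n. (norm (f i))\<^sup>2) = 1}"
    by (auto simp: PiE_def Pi_def)
  finally show ?thesis .
qed

lemma qform_cong: "(\<And>i. i < n \<Longrightarrow> f i = g i) \<Longrightarrow> qform n A f = qform n A g"
  by (simp add: qform_def)

lemma continuous_on_qform: "continuous_on S (qform n A)"
  unfolding qform_def
  by (intro continuous_intros continuous_on_product_then_coordinatewise continuous_on_id)

text \<open>Convex weights are absorbed into the vectors as square roots, and conversely each vector
  splits into its squared norm and a unit vector. The hull is thus the image of the semidefinite
  matrices of trace 1, with no bound on the rank.\<close>

lemma convex_hull_sum_list_eq:
  fixes Q :: "(nat \<Rightarrow> real) \<Rightarrow> 'e::euclidean_space"
  assumes n: "0 < n"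
    and scale: "\<And>c f. Q (\<lambda>i. c * f i) = c\<^sup>2 *\<^sub>R Q f"
    and cong: "\<And>f g. (\<And>i. i < n \<Longrightarrow> f i = g i) \<Longrightarrow> Q f = Q g"
  shows "convex hull (Q ` {f. (\<forall>i. norm (f i) \<le> 1) \<and> (\<Sum>i<n. (norm (f i))\<^sup>2) = 1}) =
    {\<Sum>x\<leftarrow>xs. Q x | xs. (\<Sum>x\<leftarrow>xs. qform n delta x) = 1}" (is "convex hull (Q ` ?S) = ?K")
proof
  show "convex hull (Q ` ?S) \<subseteq> ?K"
  proof (rule hull_minimal)
    show "Q ` ?S \<subseteq> ?K"
    proof
      fix k assume "k \<in> Q ` ?S"
      then obtain f where "f \<in> ?S" "k = Q f" by blast
      then show "k \<in> ?K" by (intro CollectI exI[of _ "[f]"]) (simp add: qform_delta)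
    qed
    have scN: "(\<Sum>x\<leftarrow>map (\<lambda>f i. c * f i) xs. qform n delta x) = c\<^sup>2 * (\<Sum>x\<leftarrow>xs. qform n delta x)" for c xs
      by (induction xs) (simp_all add: qform_scale algebra_simps)
    have scQ: "(\<Sum>x\<leftarrow>map (\<lambda>f i. c * f i) xs. Q x) = c\<^sup>2 *\<^sub>R (\<Sum>x\<leftarrow>xs. Q x)" for c xs
      by (induction xs) (simp_all add: scale algebra_simps)
    show "convex ?K"
    proof (rule convexI)
      fix k k' :: 'e and u v :: real
      assume "k \<in> ?K" "k' \<in> ?K" and uv: "0 \<le> u" "0 \<le> v" "u + v = 1"
      then obtain xs ys where k: "k = (\<Sum>x\<leftarrow>xs. Q x)" "(\<Sum>x\<leftarrow>xs. qform n delta x) = 1"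
        "k' = (\<Sum>x\<leftarrow>ys. Q x)" "(\<Sum>x\<leftarrow>ys. qform n delta x) = 1" by blast
      show "u *\<^sub>R k + v *\<^sub>R k' \<in> ?K"
        by (rule CollectI, rule exI[of _ "map (\<lambda>f i. sqrt u * f i) xs @ map (\<lambda>f i. sqrt v * f i) ys"])
           (simp only: map_append sum_list_append scN scQ, simp add: k uv)
    qed
  qed
  show "?K \<subseteq> convex hull (Q ` ?S)"
  proof
    fix k assume "k \<in> ?K"
    then obtain xs where k: "k = (\<Sum>x\<leftarrow>xs. Q x)" and N: "(\<Sum>x\<leftarrow>xs. qform n delta x) = 1" by blast
    \<comment> \<open>Normalises \<open>f\<close>. A vector vanishing below \<open>n\<close> goes to
      the first unit vector, and coordinates from \<open>n\<close> on become 0, so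
      \<open>g f\<close> always lies in \<open>?S\<close>.\<close>
    define g where "g = (\<lambda>f i. if qform n delta f = 0 then if i = 0 then 1 else 0
        else if i < n then 1 / sqrt (qform n delta f) * f i else 0 :: real)"
    have g1: "(\<Sum>i<n. (g f i)\<^sup>2) = 1" for f
    proof (cases "qform n delta f = 0")
      case True
      then show ?thesis using n by (simp add: g_def if_distrib[of "\<lambda>x. x\<^sup>2"] cong: if_cong)
    next
      case False
      then have "(\<Sum>i<n. (g f i)\<^sup>2) = qform n delta (\<lambda>i. 1 / sqrt (qform n delta f) * f i)"
        by (simp add: g_def qform_delta)
      also have "\<dots> = 1"
        using False qform_delta_nonneg[of n f] by (simp only: qform_scale) (simp add: power_divide)
      finally show ?thesis .
    qed
    have gS: "g f \<in> ?S" for f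
    proof -
      have "norm (g f i) \<le> 1" for i
      proof (cases "i < n")
        case True
        then have "(g f i)\<^sup>2 \<le> (\<Sum>i<n. (g f i)\<^sup>2)" by (intro member_le_sum) auto
        then show ?thesis by (simp add: g1 abs_square_le_1)
      next
        case False
        then show ?thesis using n by (simp add: g_def)
      qed
      then show ?thesis using g1[of f] by simp
    qed
    have Qg: "Q f = qform n delta f *\<^sub>R Q (g f)" for f
    proof (cases "qform n delta f = 0")
      case True
      then have "Q f = Q (\<lambda>i. 0 * f i)" by (intro cong) (simp add: qform_delta_zero_iff)
      then show ?thesis using True unfolding scale by simp
    next
      case False
      then have "Q (g f) = Q (\<lambda>i. 1 / sqrt (qform n delta f) * f i)" by (intro cong) (simp add: g_def)
      then show ?thesis using False qform_delta_nonneg[of n f] unfolding scale by (simp add: power_divide)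
    qed
    have "k = (\<Sum>i<length xs. qform n delta (xs ! i) *\<^sub>R Q (g (xs ! i)))"
      unfolding k by (simp add: sum_list_sum_nth atLeast0LessThan Qg[symmetric])
    also have "\<dots> \<in> convex hull (Q ` ?S)"
    proof (rule convex_sum)
      show "(\<Sum>i<length xs. qform n delta (xs ! i)) = 1"
        using N by (simp add: sum_list_sum_nth atLeast0LessThan)
      show "Q (g (xs ! i)) \<in> convex hull (Q ` ?S)" for i
        by (intro hull_inc imageI gS)
    qed (auto simp: qform_delta_nonneg)
    finally show "k \<in> convex hull (Q ` ?S)" .
  qed
qed

text \<open>Separation gives a semidefinite matrix with nonnegative values, compactness one with the
  largest minimum, and the previous reduction shortens its list of vectors. List length serves in
  place of rank.\<close>

lemma two_vectors_suffice:
  fixes A :: "'e::euclidean_space \<Rightarrow> nat \<Rightarrow> nat \<Rightarrow> real"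
  assumes dim: "DIM('e) \<le> 5" and n: "0 < n"
    and hyp: "\<And>d. \<forall>b\<in>Basis. 0 < d b \<Longrightarrow>
      \<exists>f. 0 < qform n delta f \<and> 0 \<le> (\<Sum>b\<in>Basis. d b * qform n (A b) f)"
  shows "\<exists>x y. 0 < qform n delta x + qform n delta y \<and> (\<forall>b\<in>Basis. 0 \<le> qform n (A b) x + qform n (A b) y)"
proof -
  define Q where "Q = (\<lambda>f. \<Sum>b\<in>Basis. qform n (A b) f *\<^sub>R b)"
  have Qb: "Q f \<bullet> b = qform n (A b) f" if "b \<in> Basis" for f b
    using that by (simp add: Q_def)
  define S where "S = {f :: nat \<Rightarrow> real. (\<forall>i. norm (f i) \<le> 1) \<and> (\<Sum>i<n. (norm (f i))\<^sup>2) = 1}"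
  define K where "K = convex hull (Q ` S)"
  have K_eq: "K = {\<Sum>x\<leftarrow>xs. Q x | xs. (\<Sum>x\<leftarrow>xs. qform n delta x) = 1}"
    unfolding K_def S_def
  proof (rule convex_hull_sum_list_eq[OF n])
    show "Q (\<lambda>i. c * f i) = c\<^sup>2 *\<^sub>R Q f" for c f
      by (simp add: Q_def qform_scale scaleR_sum_right)
    show "Q f = Q g" if "\<And>i. i < n \<Longrightarrow> f i = g i" for f g
      using qform_cong[OF that] by (simp add: Q_def)
  qed
  have lQ: "(\<Sum>x\<leftarrow>xs. Q x) \<bullet> b = (\<Sum>x\<leftarrow>xs. qform n (A b) x)" if "b \<in> Basis" for xs b
    by (induction xs) (simp_all add: Qb[OF that] inner_add_left)
  have "continuous_on S Q"
    unfolding Q_def by (intro continuous_intros continuous_on_qform)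
  then have compK: "compact K"
    unfolding K_def using compact_unit_sphere_coordinates[of n, where 'a = real]
    by (intro compact_convex_hull compact_continuous_image) (simp_all add: S_def)
  have convK: "convex K" by (simp add: K_def)
  have "(\<lambda>i. if i = 0 then 1 else 0) \<in> S"
    using n by (simp add: S_def if_distrib[of "\<lambda>x. x\<^sup>2"] cong: if_cong)
  then have neK: "K \<noteq> {}" by (auto simp: K_def)
  define P where "P = {p :: 'e. \<forall>b\<in>Basis. 0 \<le> p \<bullet> b}"
  have P: "convex P" "closed P" "0 \<in> P"
  proof -
    have "P = (\<Inter>b\<in>Basis. {p. 0 \<le> b \<bullet> p})" by (auto simp: P_def inner_commute)
    then show "convex P" "closed P"
      by (auto intro!: convex_INT closed_INT convex_halfspace_ge closed_halfspace_ge)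
    show "0 \<in> P" by (simp add: P_def)
  qed
  have meet: "K \<inter> P \<noteq> {}"
  proof
    assume "K \<inter> P = {}"
    then obtain a \<beta> where sep: "\<forall>x\<in>K. inner a x < \<beta>" "\<forall>x\<in>P. inner a x > \<beta>"
      using separating_hyperplane_compact_closed[OF convK compK neK P(1,2)] by blast
    have \<beta>: "\<beta> < 0" using sep(2) P(3) by auto
    \<comment> \<open>Otherwise the functional \<open>a\<close> would attain the value \<beta> at a
      point of the cone \<open>P\<close> on the ray through \<open>b\<close>.\<close>
    have a: "0 \<le> a \<bullet> b" if b: "b \<in> Basis" for b
    proof (rule ccontr)
      assume neg: "\<not> 0 \<le> a \<bullet> b"
      define t where "t = \<beta> / (a \<bullet> b)"
      have "t *\<^sub>R b \<in> P" using b \<beta> neg by (auto simp: P_def inner_Basis t_def divide_nonpos_neg)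
      then have "\<beta> < t * (a \<bullet> b)" using sep(2) by (auto simp del: scaleR_conv_of_real)
      then show False using neg by (simp add: t_def)
    qed
    obtain C where C: "\<forall>x\<in>K. norm x \<le> C" using compact_imp_bounded[OF compK] by (auto simp: bounded_iff)
    define o1 where "o1 = (\<Sum>b\<in>Basis. b :: 'e)"
    have o1: "o1 \<bullet> v = (\<Sum>b\<in>Basis. v \<bullet> b)" for v
      unfolding o1_def inner_sum_left by (simp add: inner_commute)
    \<comment> \<open>Separation yields only nonnegative weights, whereas \<open>hyp\<close> asks
      for positive ones. Adding this \<epsilon> to every weight changes the functional on the
      bounded set \<open>K\<close> by less than the gap -\<beta>.\<close>
    define \<epsilon> where "\<epsilon> = - \<beta> / (norm o1 * \<bar>C\<bar> + 1)"
    have den: "norm o1 * \<bar>C\<bar> + 1 > 0" by (simp add: add_nonneg_pos)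
    have \<epsilon>: "\<epsilon> > 0" using divide_neg_pos[OF \<beta> den] by (simp add: \<epsilon>_def)
    obtain f where f: "0 < qform n delta f" "0 \<le> (\<Sum>b\<in>Basis. (a \<bullet> b + \<epsilon>) * qform n (A b) f)"
      using hyp[of "\<lambda>b. a \<bullet> b + \<epsilon>"] a \<epsilon> by (auto simp: add_nonneg_pos)
    define c where "c = 1 / sqrt (qform n delta f)"
    have c: "c > 0" using f by (simp add: c_def)
    define g where "g = (\<lambda>i. c * f i)"
    have "qform n delta g = 1" using f unfolding g_def qform_scale by (simp add: c_def power_divide)
    then have gK: "Q g \<in> K" unfolding K_eq by (intro CollectI exI[of _ "[g]"]) simp
    have "0 \<le> c\<^sup>2 * (\<Sum>b\<in>Basis. (a \<bullet> b + \<epsilon>) * qform n (A b) f)" using f by simp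
    also have "\<dots> = (\<Sum>b\<in>Basis. (a \<bullet> b + \<epsilon>) * (Q g \<bullet> b))"
      by (simp add: g_def qform_scale Qb sum_distrib_left algebra_simps)
    also have "\<dots> = a \<bullet> Q g + \<epsilon> * (o1 \<bullet> Q g)"
      by (simp add: euclidean_inner[of a "Q g"] o1 algebra_simps sum.distrib sum_distrib_left)
    also have "\<epsilon> * (o1 \<bullet> Q g) \<le> \<epsilon> * (norm o1 * \<bar>C\<bar>)"
    proof (rule mult_left_mono)
      have "o1 \<bullet> Q g \<le> norm o1 * norm (Q g)" by (rule norm_cauchy_schwarz)
      also have "\<dots> \<le> norm o1 * \<bar>C\<bar>" using C gK by (intro mult_left_mono) auto
      finally show "o1 \<bullet> Q g \<le> norm o1 * \<bar>C\<bar>" .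
    qed (use \<epsilon> in simp)
    also have "\<epsilon> * (norm o1 * \<bar>C\<bar>) < \<epsilon> * (norm o1 * \<bar>C\<bar> + 1)" using \<epsilon> by simp
    also have "\<epsilon> * (norm o1 * \<bar>C\<bar> + 1) = - \<beta>" using den by (simp add: \<epsilon>_def)
    finally show False using sep(1) gK by fastforce
  qed
  have "continuous_on K (\<lambda>k. Min ((\<lambda>b. k \<bullet> b) ` (Basis :: 'e set)))"
    by (intro continuous_on_Min_image continuous_intros) auto
  then obtain k0 where k0: "k0 \<in> K"
    and k0_max: "\<And>k. k \<in> K \<Longrightarrow> Min ((\<lambda>b. k \<bullet> b) ` Basis) \<le> Min ((\<lambda>b. k0 \<bullet> b) ` Basis)"
    using continuous_attains_sup[OF compK neK] by blast
  define m where "m = Min ((\<lambda>b. k0 \<bullet> b) ` Basis)"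
  have m_ge: "m \<ge> 0"
  proof -
    obtain k where "k \<in> K" "k \<in> P" using meet by blast
    then have "0 \<le> Min ((\<lambda>b. k \<bullet> b) ` Basis)" by (simp add: P_def)
    also have "\<dots> \<le> m" unfolding m_def by (rule k0_max) fact
    finally show ?thesis .
  qed
  have max: "\<not> (\<forall>b\<in>Basis. m < k \<bullet> b)" if "k \<in> K" for k
    using k0_max[OF that] unfolding m_def[symmetric] by (subst (asm) Min_le_iff) (auto simp: not_less)
  \<comment> \<open>Some list of \<open>r\<close> vectors reaches the optimal minimum
    \<open>m\<close>; the least such \<open>r\<close> is taken below.\<close>
  define R where "R = (\<lambda>r. \<exists>xs. length xs = r \<and> (\<Sum>x\<leftarrow>xs. qform n delta x) = 1 \<and>
      (\<forall>b\<in>Basis. m \<le> (\<Sum>x\<leftarrow>xs. qform n (A b) x)))"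
  have "\<exists>r. R r"
  proof -
    obtain xs where "k0 = (\<Sum>x\<leftarrow>xs. Q x)" "(\<Sum>x\<leftarrow>xs. qform n delta x) = 1" using k0 unfolding K_eq by blast
    moreover have "m \<le> k0 \<bullet> b" if "b \<in> Basis" for b using that by (simp add: m_def)
    ultimately show ?thesis by (auto simp: R_def lQ)
  qed
  then obtain r where r: "R r" and rmin: "\<And>r'. r' < r \<Longrightarrow> \<not> R r'"
    using exists_least_iff[of R] by blast
  then obtain xs where xs: "length xs = r" "(\<Sum>x\<leftarrow>xs. qform n delta x) = 1"
    "\<And>b. b \<in> Basis \<Longrightarrow> m \<le> (\<Sum>x\<leftarrow>xs. qform n (A b) x)" by (auto simp: R_def)
  have zero: "qform n C (\<lambda>i. 0) = 0" for C by (simp add: qform_def)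
  consider "xs = []" | u where "xs = [u]" | u v where "xs = [u, v]" | u v w ys where "xs = u # v # w # ys"
    by (metis neq_Nil_conv)
  then show ?thesis
  proof cases
    case 1
    then show ?thesis using xs(2) by simp
  next
    case 2
    then show ?thesis using xs(2,3) m_ge by (intro exI[of _ u] exI[of _ "\<lambda>i. 0"]) (auto simp: zero intro: order_trans)
  next
    case 3
    then show ?thesis using xs(2,3) m_ge by (intro exI[of _ u] exI[of _ v]) (auto intro: order_trans)
  next
    case 4
    \<comment> \<open>Applied to the first three vectors: a strict increase contradicts the
      maximality of \<open>m\<close>, a replacement by two vectors the minimality of
      \<open>r\<close>.\<close>
    from three_vectors_reducible[OF dim, of n u v w A] show ?thesis
    proof (elim disjE exE conjE)
      fix zs
      assume z: "(\<Sum>x\<leftarrow>zs. qform n delta x) = qform n delta u + qform n delta v + qform n delta w"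
        "\<forall>b\<in>Basis. (\<Sum>x\<leftarrow>zs. qform n (A b) x) > qform n (A b) u + qform n (A b) v + qform n (A b) w"
      have "(\<Sum>x\<leftarrow>zs @ ys. Q x) \<in> K"
        unfolding K_eq by (rule CollectI, rule exI[of _ "zs @ ys"]) (use xs(2) 4 z(1) in simp)
      moreover have "m < (\<Sum>x\<leftarrow>zs @ ys. Q x) \<bullet> b" if "b \<in> Basis" for b
        unfolding lQ[OF that] using xs(3)[OF that] z(2) 4 that by fastforce
      ultimately show ?thesis using max by blast
    next
      fix x y
      assume z: "qform n delta x + qform n delta y = qform n delta u + qform n delta v + qform n delta w"
        "\<forall>b\<in>Basis. qform n (A b) x + qform n (A b) y = qform n (A b) u + qform n (A b) v + qform n (A b) w"
      have "R (length (x # y # ys))"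
        unfolding R_def by (rule exI[of _ "x # y # ys"]) (use xs 4 z in \<open>simp add: add.assoc[symmetric]\<close>)
      then show ?thesis using rmin[of "length (x # y # ys)"] xs(1) 4 by simp
    qed
  qed
qed

subsection \<open>The largest singular value\<close>

definition sqnorm_vec :: "complex Matrix.vec \<Rightarrow> real" where
  "sqnorm_vec v = (\<Sum>i<dim_vec v. (cmod (v $ i))\<^sup>2)"

lemma sqnorm_vec_nonneg: "0 \<le> sqnorm_vec v"
  by (simp add: sqnorm_vec_def sum_nonneg)

lemma sqnorm_vec_eq_0_iff: "v \<in> carrier_vec n \<Longrightarrow> sqnorm_vec v = 0 \<longleftrightarrow> v = 0\<^sub>v n"
  by (auto simp: sqnorm_vec_def sum_nonneg_eq_0_iff)

lemma sqnorm_vec_smult: "sqnorm_vec (c \<cdot>\<^sub>v v) = (cmod c)\<^sup>2 * sqnorm_vec v"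
  by (simp add: sqnorm_vec_def sum_distrib_left norm_mult power_mult_distrib)

definition cinner :: "complex Matrix.vec \<Rightarrow> complex Matrix.vec \<Rightarrow> complex" where
  "cinner u v = (\<Sum>i<dim_vec v. u $ i * cnj (v $ i))"

lemma cinner_self: "cinner v v = complex_of_real (sqnorm_vec v)"
  unfolding cinner_def sqnorm_vec_def of_real_sum complex_norm_square ..

lemma cinner_diff_left:
  "u \<in> carrier_vec n \<Longrightarrow> v \<in> carrier_vec n \<Longrightarrow> w \<in> carrier_vec n \<Longrightarrow> cinner (u - v) w = cinner u w - cinner v w"
  by (simp add: cinner_def sum_subtractf algebra_simps)

lemma cinner_smult_left:
  "u \<in> carrier_vec n \<Longrightarrow> w \<in> carrier_vec n \<Longrightarrow> cinner (c \<cdot>\<^sub>v u) w = c * cinner u w"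
  by (simp add: cinner_def sum_distrib_left mult.assoc)

lemma sqnorm_vec_add_smult:
  assumes "u \<in> carrier_vec n" "w \<in> carrier_vec n"
  shows "sqnorm_vec (u + complex_of_real t \<cdot>\<^sub>v w) = sqnorm_vec u + 2 * t * Re (cinner u w) + t\<^sup>2 * sqnorm_vec w"
proof -
  have "(cmod (a + of_real t * b))\<^sup>2 = (cmod a)\<^sup>2 + 2 * t * Re (a * cnj b) + t\<^sup>2 * (cmod b)\<^sup>2" for a b
    unfolding cmod_power2 by (simp add: power2_eq_square algebra_simps)
  then show ?thesis
    using assms by (simp add: sqnorm_vec_def cinner_def sum.distrib sum_distrib_left distrib_left)
qed

lemma index_mult_mat_vec_sum:
  assumes "A \<in> carrier_mat m n" "v \<in> carrier_vec n" "i < m"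
  shows "(A *\<^sub>v v) $ i = (\<Sum>k<n. A $$ (i, k) * v $ k)"
  using assms by (simp add: scalar_prod_def atLeast0LessThan)

lemma mat_adjoint_carrier: "A \<in> carrier_mat m n \<Longrightarrow> mat_adjoint A \<in> carrier_mat n m"
  by (auto simp: mat_adjoint_def)

lemma index_mat_adjoint:
  "A \<in> carrier_mat m n \<Longrightarrow> i < n \<Longrightarrow> k < m \<Longrightarrow> mat_adjoint A $$ (i, k) = cnj (A $$ (k, i))"
  by (auto simp: mat_adjoint_def mat_of_rows_index)

lemma cinner_adjoint:
  assumes A: "A \<in> carrier_mat m n" and z: "z \<in> carrier_vec m" and y: "y \<in> carrier_vec n"
  shows "cinner (mat_adjoint A *\<^sub>v z) y = cinner z (A *\<^sub>v y)"
proof -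
  have "cinner (mat_adjoint A *\<^sub>v z) y = (\<Sum>i<n. (\<Sum>k<m. cnj (A $$ (k, i)) * z $ k) * cnj (y $ i))"
    using y by (simp add: cinner_def index_mult_mat_vec_sum[OF mat_adjoint_carrier[OF A] z] index_mat_adjoint[OF A]
        del: index_mult_mat_vec)
  also have "\<dots> = (\<Sum>k<m. z $ k * cnj (\<Sum>i<n. A $$ (k, i) * y $ i))"
    unfolding sum_distrib_right cnj_sum sum_distrib_left
    by (subst sum.swap) (simp add: mult_ac)
  also have "\<dots> = cinner z (A *\<^sub>v y)"
    using A by (simp add: cinner_def index_mult_mat_vec_sum[OF A y] del: index_mult_mat_vec)
  finally show ?thesis .
qed

section \<open>Singular values and maximal stretch\<close>

lemma finite_singular_values:
  assumes A: "A \<in> carrier_mat m n"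
  shows "finite (singular_values A)"
proof -
  define H where "H = mat_adjoint A * A"
  have H: "H \<in> carrier_mat n n" using A mat_adjoint_carrier[OF A] by (simp add: H_def)
  have "char_poly H \<noteq> 0" using degree_monic_char_poly[OF H] by auto
  then have "finite {k. eigenvalue H k}"
    unfolding eigenvalue_root_char_poly[OF H] by (rule poly_roots_finite)
  moreover have "inj_on (\<lambda>s. complex_of_real (s\<^sup>2)) {0..}"
    by (auto simp: inj_on_def simp del: of_real_power)
  ultimately have "finite ((\<lambda>s. complex_of_real (s\<^sup>2)) -` {k. eigenvalue H k} \<inter> {0..})"
    by (rule finite_vimage_IntI)
  moreover have "singular_values A = (\<lambda>s. complex_of_real (s\<^sup>2)) -` {k. eigenvalue H k} \<inter> {0..}"
    by (auto simp: singular_values_def H_def)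
  ultimately show ?thesis by simp
qed

text \<open>For an eigenvector x of A^* A, |A x|^2 is the inner product of A^* A x with x.\<close>

lemma singular_value_eigenvector:
  assumes A: "A \<in> carrier_mat m n" and s: "s \<in> singular_values A"
  obtains x where "x \<in> carrier_vec n" "x \<noteq> 0\<^sub>v n" "sqnorm_vec (A *\<^sub>v x) = s\<^sup>2 * sqnorm_vec x"
proof -
  have H: "mat_adjoint A * A \<in> carrier_mat n n" using A mat_adjoint_carrier[OF A] by simp
  obtain x where x: "x \<in> carrier_vec n" "x \<noteq> 0\<^sub>v n" "(mat_adjoint A * A) *\<^sub>v x = of_real (s\<^sup>2) \<cdot>\<^sub>v x"
    using s unfolding singular_values_def eigenvalue_def eigenvector_def carrier_matD(1)[OF H] by blast
  have "complex_of_real (sqnorm_vec (A *\<^sub>v x)) = cinner (mat_adjoint A *\<^sub>v (A *\<^sub>v x)) x"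
    using A x by (subst cinner_adjoint[OF A]) (auto simp: cinner_self)
  also have "mat_adjoint A *\<^sub>v (A *\<^sub>v x) = of_real (s\<^sup>2) \<cdot>\<^sub>v x"
    using x(3) unfolding assoc_mult_mat_vec[OF mat_adjoint_carrier[OF A] A x(1)] .
  also have "cinner \<dots> x = of_real (s\<^sup>2 * sqnorm_vec x)"
    using x by (simp add: cinner_smult_left[of _ n] cinner_self)
  finally show thesis using x that by (metis of_real_eq_iff)
qed

text \<open>A unit vector \<open>u\<close> maximising |A u| satisfies the first order condition A^*
  A u = L u, where L is the maximum of |A u|^2. The largest stretch is therefore itself a singular
  value.\<close>

lemma max_stretch_singular_value:
  assumes A: "A \<in> carrier_mat m n" and n: "0 < n"
  obtains s where "s \<in> singular_values A"
    and "\<And>x. x \<in> carrier_vec n \<Longrightarrow> sqnorm_vec (A *\<^sub>v x) \<le> s\<^sup>2 * sqnorm_vec x"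
proof -
  define S where "S = {f :: nat \<Rightarrow> complex. (\<forall>i. norm (f i) \<le> 1) \<and> (\<Sum>i<n. (norm (f i))\<^sup>2) = 1}"
  define F where "F = (\<lambda>f. sqnorm_vec (A *\<^sub>v Matrix.vec n f))"
  have F: "F f = (\<Sum>j<m. (cmod (\<Sum>k<n. A $$ (j, k) * f k))\<^sup>2)" for f
    using A by (simp add: F_def sqnorm_vec_def index_mult_mat_vec_sum[OF A] del: index_mult_mat_vec)
  have "continuous_on S F"
    unfolding F by (intro continuous_intros continuous_on_product_then_coordinatewise continuous_on_id)
  moreover have "compact S" unfolding S_def by (rule compact_unit_sphere_coordinates)
  moreover have "(\<lambda>i. if i = 0 then 1 else 0) \<in> S"
    using n by (simp add: S_def if_distrib[of "\<lambda>x. (norm x)\<^sup>2"] cong: if_cong)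
  then have "S \<noteq> {}" by blast
  ultimately obtain f0 where f0: "f0 \<in> S" "\<And>f. f \<in> S \<Longrightarrow> F f \<le> F f0"
    using continuous_attains_sup[of S F] by blast
  define u where "u = Matrix.vec n f0"
  define L where "L = F f0"
  have u: "u \<in> carrier_vec n" by (simp add: u_def)
  have u1: "sqnorm_vec u = 1" using f0(1) by (simp add: u_def sqnorm_vec_def S_def)
  have Au: "sqnorm_vec (A *\<^sub>v u) = L" by (simp add: L_def F_def u_def)
  have L0: "L \<ge> 0" by (simp add: L_def F_def sqnorm_vec_nonneg)
  have bound: "sqnorm_vec (A *\<^sub>v x) \<le> L * sqnorm_vec x" if x: "x \<in> carrier_vec n" for x
  proof (cases "sqnorm_vec x = 0")
    case True
    then have "x = 0\<^sub>v n" using sqnorm_vec_eq_0_iff[OF x] by simp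
    then have "A *\<^sub>v x = 0\<^sub>v m" using A by (auto simp: scalar_prod_def)
    then show ?thesis using True sqnorm_vec_eq_0_iff[of "A *\<^sub>v x" m] by simp
  next
    case False
    define c where "c = 1 / sqrt (sqnorm_vec x)"
    have c2: "c\<^sup>2 = 1 / sqnorm_vec x" by (simp add: c_def power_divide sqnorm_vec_nonneg)
    have pos: "sqnorm_vec x > 0" using False sqnorm_vec_nonneg[of x] by simp
    define y where "y = of_real c \<cdot>\<^sub>v x"
    have y: "y \<in> carrier_vec n" "sqnorm_vec y = 1"
      using x False by (simp_all add: y_def sqnorm_vec_smult c2)
    \<comment> \<open>Extended by 0 past the dimension, since membership in \<open>S\<close> bounds
      all coordinates.\<close>
    define g where "g = (\<lambda>i. if i < n then y $ i else 0)"
    have yg: "y = Matrix.vec n g" using y(1) by (auto simp: g_def)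
    have sum1: "(\<Sum>i<n. (norm (g i))\<^sup>2) = 1" using y by (simp add: g_def sqnorm_vec_def)
    have "norm (g i) \<le> 1" for i
    proof (cases "i < n")
      case True
      then have "(norm (g i))\<^sup>2 \<le> (\<Sum>i<n. (norm (g i))\<^sup>2)"
        by (intro member_le_sum[of i "{..<n}" "\<lambda>i. (norm (g i))\<^sup>2"]) auto
      then show ?thesis unfolding sum1 by (simp add: abs_square_le_1)
    qed (simp add: g_def)
    with sum1 have "g \<in> S" by (simp add: S_def)
    then have "sqnorm_vec (A *\<^sub>v y) \<le> L" using f0(2) by (simp add: L_def F_def yg)
    also have "A *\<^sub>v y = of_real c \<cdot>\<^sub>v (A *\<^sub>v x)" using A x by (simp add: y_def mult_mat_vec)
    finally show ?thesis using pos by (simp add: sqnorm_vec_smult c2 field_simps)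
  qed
  (* u minimises L |x|^2 - |A x|^2, so the derivative of this form at u vanishes in the direction of w. *)
  define w where "w = of_real L \<cdot>\<^sub>v u - mat_adjoint A *\<^sub>v (A *\<^sub>v u)"
  have H: "mat_adjoint A *\<^sub>v (A *\<^sub>v u) \<in> carrier_vec n"
    using mat_adjoint_carrier[OF A] A u by auto
  have w: "w \<in> carrier_vec n" using u H by (simp add: w_def)
  have Aw: "A *\<^sub>v w \<in> carrier_vec m" "A *\<^sub>v u \<in> carrier_vec m" using A w u by auto
  have "sqnorm_vec w = 0"
  proof -
    \<comment> \<open>By the choice of \<open>w\<close>, the derivative in the direction
      \<open>w\<close> is twice the squared norm of \<open>w\<close>; its vanishing gives
      \<open>w = 0\<close>.\<close>
    have "cinner w w = of_real L * cinner u w - cinner (A *\<^sub>v u) (A *\<^sub>v w)"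
      by (subst w_def) (use u H w Aw A in \<open>simp add: cinner_diff_left[of _ n] cinner_smult_left[of _ n] cinner_adjoint[of A m n]\<close>)
    from arg_cong[OF this, of Re]
    have ww: "sqnorm_vec w = L * Re (cinner u w) - Re (cinner (A *\<^sub>v u) (A *\<^sub>v w))"
      by (simp add: cinner_self)
    have "2 * sqnorm_vec w = 0"
    proof (rule psd_form_gradient_zero[where g = "L * sqnorm_vec w - sqnorm_vec (A *\<^sub>v w)"])
      fix t :: real
      have "A *\<^sub>v (u + of_real t \<cdot>\<^sub>v w) = A *\<^sub>v u + of_real t \<cdot>\<^sub>v (A *\<^sub>v w)"
        using A u w by (simp add: mult_add_distrib_mat_vec mult_mat_vec)
      then have "sqnorm_vec (A *\<^sub>v u + of_real t \<cdot>\<^sub>v (A *\<^sub>v w)) \<le> L * sqnorm_vec (u + of_real t \<cdot>\<^sub>v w)"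
        using bound[of "u + of_real t \<cdot>\<^sub>v w"] u w by simp
      then show "0 \<le> 2 * sqnorm_vec w * t + (L * sqnorm_vec w - sqnorm_vec (A *\<^sub>v w)) * t\<^sup>2"
        unfolding sqnorm_vec_add_smult[OF u w] sqnorm_vec_add_smult[OF Aw(2,1)] u1 Au
        using arg_cong[OF ww, of "\<lambda>x. 2 * x * t"] by (simp add: algebra_simps)
    qed
    then show ?thesis by simp
  qed
  then have w0: "w = 0\<^sub>v n" using sqnorm_vec_eq_0_iff[OF w] by simp
  have "mat_adjoint A *\<^sub>v (A *\<^sub>v u) = of_real L \<cdot>\<^sub>v u"
  proof (rule eq_vecI)
    fix i assume "i < dim_vec (of_real L \<cdot>\<^sub>v u)"
    then have i: "i < n" using u by simp
    have "w $ i = 0" using w0 i by simp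
    then show "(mat_adjoint A *\<^sub>v (A *\<^sub>v u)) $ i = (of_real L \<cdot>\<^sub>v u) $ i"
      using i u carrier_vecD[OF H] unfolding w_def by (simp del: index_mult_mat_vec)
  qed (use u mat_adjoint_carrier[OF A] in auto)
  moreover have "u \<noteq> 0\<^sub>v n" using u1 sqnorm_vec_eq_0_iff[OF u] by auto
  ultimately have "eigenvalue (mat_adjoint A * A) (of_real ((sqrt L)\<^sup>2))"
    using A u mat_adjoint_carrier[OF A] L0
    by (auto simp: eigenvalue_def eigenvector_def assoc_mult_mat_vec intro!: exI[of _ u] simp del: of_real_power)
  then have "sqrt L \<in> singular_values A" using L0 by (simp add: singular_values_def del: of_real_power)
  then show thesis using bound L0 by (intro that[of "sqrt L"]) auto
qed

lemma
  assumes A: "A \<in> carrier_mat m n" and n: "0 < n"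
  shows max_singular_value_mem: "max_singular_value A \<in> singular_values A"
    and sqnorm_vec_mult_le: "x \<in> carrier_vec n \<Longrightarrow> sqnorm_vec (A *\<^sub>v x) \<le> (max_singular_value A)\<^sup>2 * sqnorm_vec x"
proof -
  obtain s where s: "s \<in> singular_values A"
    "\<And>x. x \<in> carrier_vec n \<Longrightarrow> sqnorm_vec (A *\<^sub>v x) \<le> s\<^sup>2 * sqnorm_vec x"
    using max_stretch_singular_value[OF A n] by blast
  note fin = finite_singular_values[OF A]
  show mem: "max_singular_value A \<in> singular_values A"
    unfolding max_singular_value_def using fin s(1) by (intro Max_in) auto
  assume x: "x \<in> carrier_vec n"
  have "s \<le> max_singular_value A" unfolding max_singular_value_def using fin s(1) by simp
  moreover have "0 \<le> s" using s(1) by (simp add: singular_values_def)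
  ultimately have "s\<^sup>2 \<le> (max_singular_value A)\<^sup>2" by (rule power_mono)
  then show "sqnorm_vec (A *\<^sub>v x) \<le> (max_singular_value A)\<^sup>2 * sqnorm_vec x"
    using s(2)[OF x] mult_right_mono[OF _ sqnorm_vec_nonneg[of x]] by (meson order_trans)
qed

lemma max_singular_value_nonneg: "A \<in> carrier_mat m n \<Longrightarrow> 0 < n \<Longrightarrow> 0 \<le> max_singular_value A"
  using max_singular_value_mem[of A m n] by (simp add: singular_values_def)

text \<open>Variational form of the largest singular value. Stating it for a lower bound
  \<open>c\<close> turns a bound on each scaled matrix into the existence of a stretched
  vector.\<close>

lemma le_max_singular_value_iff:
  assumes A: "A \<in> carrier_mat m n" and n: "0 < n" and c: "0 \<le> c"
  shows "c \<le> max_singular_value A \<longleftrightarrow>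
    (\<exists>x\<in>carrier_vec n. x \<noteq> 0\<^sub>v n \<and> c\<^sup>2 * sqnorm_vec x \<le> sqnorm_vec (A *\<^sub>v x))"
proof
  assume le: "c \<le> max_singular_value A"
  obtain x where "x \<in> carrier_vec n" "x \<noteq> 0\<^sub>v n"
    "sqnorm_vec (A *\<^sub>v x) = (max_singular_value A)\<^sup>2 * sqnorm_vec x"
    using singular_value_eigenvector[OF A max_singular_value_mem[OF A n]] by blast
  moreover have "c\<^sup>2 \<le> (max_singular_value A)\<^sup>2" using le c by (rule power_mono)
  ultimately show "\<exists>x\<in>carrier_vec n. x \<noteq> 0\<^sub>v n \<and> c\<^sup>2 * sqnorm_vec x \<le> sqnorm_vec (A *\<^sub>v x)"
    by (metis mult_right_mono sqnorm_vec_nonneg)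
next
  assume "\<exists>x\<in>carrier_vec n. x \<noteq> 0\<^sub>v n \<and> c\<^sup>2 * sqnorm_vec x \<le> sqnorm_vec (A *\<^sub>v x)"
  then obtain x where x: "x \<in> carrier_vec n" "x \<noteq> 0\<^sub>v n" "c\<^sup>2 * sqnorm_vec x \<le> sqnorm_vec (A *\<^sub>v x)" by blast
  have "c\<^sup>2 * sqnorm_vec x \<le> (max_singular_value A)\<^sup>2 * sqnorm_vec x"
    using x(3) sqnorm_vec_mult_le[OF A n x(1)] by linarith
  moreover have "0 < sqnorm_vec x"
    using x sqnorm_vec_eq_0_iff[OF x(1)] sqnorm_vec_nonneg[of x] by linarith
  ultimately have "c\<^sup>2 \<le> (max_singular_value A)\<^sup>2" by simp
  then show "c \<le> max_singular_value A"
    using max_singular_value_nonneg[OF A n] by (rule power2_le_imp_le)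
qed

lemma max_singular_value_le:
  assumes A: "A \<in> carrier_mat m n" and n: "0 < n" and c: "0 \<le> c"
    and le: "\<And>x. x \<in> carrier_vec n \<Longrightarrow> sqnorm_vec (A *\<^sub>v x) \<le> c\<^sup>2 * sqnorm_vec x"
  shows "max_singular_value A \<le> c"
proof -
  obtain x where x: "x \<in> carrier_vec n" "x \<noteq> 0\<^sub>v n"
    "sqnorm_vec (A *\<^sub>v x) = (max_singular_value A)\<^sup>2 * sqnorm_vec x"
    using singular_value_eigenvector[OF A max_singular_value_mem[OF A n]] by blast
  have "0 < sqnorm_vec x"
    using x sqnorm_vec_eq_0_iff[OF x(1)] sqnorm_vec_nonneg[of x] by linarith
  then have "(max_singular_value A)\<^sup>2 \<le> c\<^sup>2" using le[OF x(1)] x(3) by simp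
  then show ?thesis using c by (rule power2_le_imp_le)
qed

subsection \<open>Block structure\<close>

text \<open>The number of the block containing coordinate \<open>i\<close>, counted from 0;
  coordinates past the last block get \<open>length ns\<close>. It turns statements about lists of
  blocks into entrywise ones.\<close>

fun block_index :: "nat list \<Rightarrow> nat \<Rightarrow> nat" where
  "block_index [] i = 0"
| "block_index (k # ns) i = (if i < k then 0 else Suc (block_index ns (i - k)))"

lemma block_index_less: "i < sum_list ns \<Longrightarrow> block_index ns i < length ns"
  by (induction ns arbitrary: i) auto

lemma block_diagonals_Nil: "block_diagonals [] = {0\<^sub>m 0 0}"
  by (simp add: block_diagonals_def)

lemma block_diagonals_Cons:
  "block_diagonals (k # ns) =
    {four_block_mat A (0\<^sub>m k (dim_col B)) (0\<^sub>m (dim_row B) k) B | A B. A \<in> carrier_mat k k \<and> B \<in> block_diagonals ns}"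
    (is "?L = ?R")
proof -
  have *: "diag_block_mat (A # As) = four_block_mat A (0\<^sub>m k (dim_col (diag_block_mat As)))
      (0\<^sub>m (dim_row (diag_block_mat As)) k) (diag_block_mat As)"
    if "A \<in> carrier_mat k k" for A :: "complex mat" and As
    using that by (simp add: Let_def)
  show ?thesis
  proof (intro equalityI subsetI)
    fix \<Delta> assume "\<Delta> \<in> ?L"
    then obtain As' where As': "\<Delta> = diag_block_mat As'" "list_all2 (\<lambda>A k. A \<in> carrier_mat k k) As' (k # ns)"
      unfolding block_diagonals_def by blast
    then obtain A As where A: "As' = A # As" "A \<in> carrier_mat k k" "list_all2 (\<lambda>A k. A \<in> carrier_mat k k) As ns"
      unfolding list_all2_Cons2 by blast
    have "diag_block_mat As \<in> block_diagonals ns"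
      unfolding block_diagonals_def by (rule CollectI, rule exI[of _ As], rule conjI[OF refl A(3)])
    then show "\<Delta> \<in> ?R" using A(2) unfolding As'(1) A(1) *[OF A(2)] by blast
  next
    fix \<Delta> assume "\<Delta> \<in> ?R"
    then obtain A As where A: "A \<in> carrier_mat k k" "list_all2 (\<lambda>A k. A \<in> carrier_mat k k) As ns"
      and A3: "\<Delta> = diag_block_mat (A # As)"
    proof -
      obtain A B where AB: "\<Delta> = four_block_mat A (0\<^sub>m k (dim_col B)) (0\<^sub>m (dim_row B) k) B"
        "A \<in> carrier_mat k k" "B \<in> block_diagonals ns"
        using \<open>\<Delta> \<in> ?R\<close> by blast
      obtain As where As: "B = diag_block_mat As" "list_all2 (\<lambda>A k. A \<in> carrier_mat k k) As ns"
        using AB(3) unfolding block_diagonals_def by blast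
      show thesis by (rule that[OF AB(2) As(2)]) (simp only: AB(1) As(1) *[OF AB(2)])
    qed
    have "list_all2 (\<lambda>A k. A \<in> carrier_mat k k) (A # As) (k # ns)" using A by simp
    then show "\<Delta> \<in> ?L"
      unfolding block_diagonals_def A3 by blast
  qed
qed

text \<open>Induction on the blocks; for the converse the leading corner and the shifted remainder
  of the matrix are cut out.\<close>

lemma block_diagonals_iff:
  "\<Delta> \<in> block_diagonals ns \<longleftrightarrow> \<Delta> \<in> carrier_mat (sum_list ns) (sum_list ns) \<and>
    (\<forall>i<sum_list ns. \<forall>j<sum_list ns. block_index ns i \<noteq> block_index ns j \<longrightarrow> \<Delta> $$ (i, j) = 0)"
proof (induction ns arbitrary: \<Delta>)
  case Nil
  then show ?case by (auto simp: block_diagonals_Nil)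
next
  case (Cons k ns)
  let ?n = "sum_list ns"
  show ?case
  proof
    assume "\<Delta> \<in> block_diagonals (k # ns)"
    then obtain A B where \<Delta>: "\<Delta> = four_block_mat A (0\<^sub>m k (dim_col B)) (0\<^sub>m (dim_row B) k) B"
      and A: "A \<in> carrier_mat k k" and B: "B \<in> block_diagonals ns"
      unfolding block_diagonals_Cons by blast
    have B': "B \<in> carrier_mat ?n ?n"
      "\<And>i j. i < ?n \<Longrightarrow> j < ?n \<Longrightarrow> block_index ns i \<noteq> block_index ns j \<Longrightarrow> B $$ (i, j) = 0"
      using B unfolding Cons.IH by auto
    show "\<Delta> \<in> carrier_mat (sum_list (k # ns)) (sum_list (k # ns)) \<and>
      (\<forall>i<sum_list (k # ns). \<forall>j<sum_list (k # ns). block_index (k # ns) i \<noteq> block_index (k # ns) j \<longrightarrow> \<Delta> $$ (i, j) = 0)"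
      unfolding \<Delta> using A B' by auto
  next
    assume *: "\<Delta> \<in> carrier_mat (sum_list (k # ns)) (sum_list (k # ns)) \<and>
      (\<forall>i<sum_list (k # ns). \<forall>j<sum_list (k # ns). block_index (k # ns) i \<noteq> block_index (k # ns) j \<longrightarrow> \<Delta> $$ (i, j) = 0)"
    define A where "A = Matrix.mat k k (\<lambda>(i, j). \<Delta> $$ (i, j))"
    define B where "B = Matrix.mat ?n ?n (\<lambda>(i, j). \<Delta> $$ (i + k, j + k))"
    have A: "A \<in> carrier_mat k k" by (simp add: A_def)
    have "B \<in> block_diagonals ns" unfolding Cons.IH
    proof (intro conjI allI impI)
      fix i j assume "i < ?n" "j < ?n" "block_index ns i \<noteq> block_index ns j"
      then show "B $$ (i, j) = 0" using conjunct2[OF *, rule_format, of "i + k" "j + k"] by (simp add: B_def)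
    qed (simp add: B_def)
    moreover have "\<Delta> = four_block_mat A (0\<^sub>m k (dim_col B)) (0\<^sub>m (dim_row B) k) B"
    proof (rule eq_matI)
      fix i j assume "i < dim_row (four_block_mat A (0\<^sub>m k (dim_col B)) (0\<^sub>m (dim_row B) k) B)"
        "j < dim_col (four_block_mat A (0\<^sub>m k (dim_col B)) (0\<^sub>m (dim_row B) k) B)"
      then have ij: "i < k + ?n" "j < k + ?n" by (auto simp: A_def B_def)
      then show "\<Delta> $$ (i, j) = four_block_mat A (0\<^sub>m k (dim_col B)) (0\<^sub>m (dim_row B) k) B $$ (i, j)"
        using conjunct2[OF *, rule_format, of i j] by (auto simp: A_def B_def)
    qed (use * in \<open>auto simp: A_def B_def\<close>)
    ultimately show "\<Delta> \<in> block_diagonals (k # ns)" unfolding block_diagonals_Cons using A by blast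
  qed
qed

lemma diag_block_mat_scalars:
  fixes ds :: "real list"
  assumes "length ds = length ns"
  shows "diag_block_mat (map2 (\<lambda>d k. d \<cdot>\<^sub>m 1\<^sub>m k) ds ns) = mat_diag (sum_list ns) (\<lambda>i. ds ! block_index ns i)"
  using assms
proof (induction ds ns rule: list_induct2)
  case Nil
  then show ?case by (auto simp: mat_diag_def)
next
  case (Cons d ds k ns)
  show ?case
  proof (rule eq_matI)
    fix i j
    assume "i < dim_row (mat_diag (sum_list (k # ns)) (\<lambda>i. (d # ds) ! block_index (k # ns) i))"
      "j < dim_col (mat_diag (sum_list (k # ns)) (\<lambda>i. (d # ds) ! block_index (k # ns) i))"
    then have "i < k + sum_list ns" "j < k + sum_list ns" by (auto simp: mat_diag_def)
    then show "diag_block_mat (map2 (\<lambda>d k. d \<cdot>\<^sub>m 1\<^sub>m k) (d # ds) (k # ns)) $$ (i, j) =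
        mat_diag (sum_list (k # ns)) (\<lambda>i. (d # ds) ! block_index (k # ns) i) $$ (i, j)"
      by (auto simp: Let_def Cons.IH mat_diag_def)
  qed (simp_all add: Let_def Cons.IH mat_diag_def)
qed

definition block_sqnorm :: "nat list \<Rightarrow> nat \<Rightarrow> complex Matrix.vec \<Rightarrow> real" where
  "block_sqnorm ns j v = (\<Sum>i | i < sum_list ns \<and> block_index ns i = j. (cmod (v $ i))\<^sup>2)"

lemma block_sqnorm_nonneg: "0 \<le> block_sqnorm ns j v"
  by (simp add: block_sqnorm_def sum_nonneg)

lemma block_sqnorm_eq_0D:
  "block_sqnorm ns (block_index ns i) v = 0 \<Longrightarrow> i < sum_list ns \<Longrightarrow> v $ i = 0"
  by (simp add: block_sqnorm_def sum_nonneg_eq_0_iff)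

lemma sum_blocks:
  fixes f :: "nat \<Rightarrow> 'a::comm_monoid_add"
  shows "(\<Sum>j<length ns. \<Sum>i | i < sum_list ns \<and> block_index ns i = j. f i) = (\<Sum>i<sum_list ns. f i)"
  using sum.group[of "{..<sum_list ns}" "{..<length ns}" "block_index ns" f] block_index_less[of _ ns]
  by (auto simp: conj_commute)

lemma sum_block_sqnorm:
  "v \<in> carrier_vec (sum_list ns) \<Longrightarrow> (\<Sum>j<length ns. block_sqnorm ns j v) = sqnorm_vec v"
  unfolding block_sqnorm_def sqnorm_vec_def sum_blocks by simp

text \<open>A block-diagonal matrix commutes with the projection onto block \<open>j\<close>, so the
  norm bound applies to the projected vector \<open>w\<close>.\<close>

lemma block_sqnorm_block_diagonal_le:
  assumes \<Delta>: "\<Delta> \<in> block_diagonals ns" and n: "0 < sum_list ns" and v: "v \<in> carrier_vec (sum_list ns)"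
  shows "block_sqnorm ns j (\<Delta> *\<^sub>v v) \<le> (max_singular_value \<Delta>)\<^sup>2 * block_sqnorm ns j v"
proof -
  let ?n = "sum_list ns"
  have C: "\<Delta> \<in> carrier_mat ?n ?n"
    and Z: "\<And>i k. i < ?n \<Longrightarrow> k < ?n \<Longrightarrow> block_index ns i \<noteq> block_index ns k \<Longrightarrow> \<Delta> $$ (i, k) = 0"
    using \<Delta> by (auto simp: block_diagonals_iff)
  define w where "w = Matrix.vec ?n (\<lambda>i. if block_index ns i = j then v $ i else 0)"
  have w: "w \<in> carrier_vec ?n" by (simp add: w_def)
  have eq: "{..<?n} \<inter> {i. block_index ns i = j} = {i. i < ?n \<and> block_index ns i = j}" by auto
  have sw: "sqnorm_vec w = block_sqnorm ns j v"
    by (simp add: w_def sqnorm_vec_def block_sqnorm_def if_distrib[of cmod] if_distrib[of "\<lambda>x. x\<^sup>2"] sum.If_cases eq cong: if_cong)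
  have "(\<Delta> *\<^sub>v w) $ i = (if block_index ns i = j then (\<Delta> *\<^sub>v v) $ i else 0)" if i: "i < ?n" for i
  proof -
    have "(\<Delta> *\<^sub>v w) $ i = (\<Sum>k<?n. \<Delta> $$ (i, k) * w $ k)" by (rule index_mult_mat_vec_sum[OF C w i])
    also have "\<dots> = (\<Sum>k<?n. if block_index ns i = j then \<Delta> $$ (i, k) * v $ k else 0)"
      using Z[OF i] by (intro sum.cong) (auto simp: w_def)
    also have "\<dots> = (if block_index ns i = j then (\<Delta> *\<^sub>v v) $ i else 0)"
      using index_mult_mat_vec_sum[OF C v i] by simp
    finally show ?thesis .
  qed
  then have "sqnorm_vec (\<Delta> *\<^sub>v w) = block_sqnorm ns j (\<Delta> *\<^sub>v v)"
    using C by (simp add: sqnorm_vec_def block_sqnorm_def if_distrib[of cmod] if_distrib[of "\<lambda>x. x\<^sup>2"] sum.If_cases eq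
        del: index_mult_mat_vec cong: if_cong)
  then show ?thesis using sqnorm_vec_mult_le[OF C n w] sw by simp
qed

section \<open>Singular perturbations and blockwise stretched vectors\<close>

lemma det_one_minus_mult_eq_0_iff:
  assumes C: "C \<in> carrier_mat n n" and D: "D \<in> carrier_mat n n"
  shows "det (1\<^sub>m n - C * D) = 0 \<longleftrightarrow> (\<exists>w\<in>carrier_vec n. w \<noteq> 0\<^sub>v n \<and> C *\<^sub>v (D *\<^sub>v w) = (w :: complex Matrix.vec))"
proof -
  have CD: "C * D \<in> carrier_mat n n" using C D by simp
  have "(1\<^sub>m n - C * D) *\<^sub>v w = 0\<^sub>v n \<longleftrightarrow> C *\<^sub>v (D *\<^sub>v w) = w" if w: "w \<in> carrier_vec n" for w
  proof -
    have "(1\<^sub>m n - C * D) *\<^sub>v w = w - C *\<^sub>v (D *\<^sub>v w)"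
      using C D w by (simp add: minus_mult_distrib_mat_vec[of _ n n])
    moreover have "C *\<^sub>v (D *\<^sub>v w) \<in> carrier_vec n" using C D w by auto
    ultimately show ?thesis using w by (auto simp: vec_eq_iff)
  qed
  then show ?thesis
    using det_0_iff_vec_prod_zero[OF minus_carrier_mat[OF CD, of "1\<^sub>m n"]] by blast
qed

text \<open>The assertion G(c) from the introduction, with its witness \<open>x\<close> as an
  argument.\<close>

definition blockwise_stretched :: "nat list \<Rightarrow> complex mat \<Rightarrow> real \<Rightarrow> complex Matrix.vec \<Rightarrow> bool" where
  "blockwise_stretched ns C c x \<longleftrightarrow> x \<in> carrier_vec (sum_list ns) \<and> x \<noteq> 0\<^sub>v (sum_list ns) \<and>
     (\<forall>j<length ns. c\<^sup>2 * block_sqnorm ns j x \<le> block_sqnorm ns j (C *\<^sub>v x))"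

text \<open>If C \<Delta> w = w, then x = \<Delta> w satisfies C x = w, and the block bound for
  \<Delta> compares x with C x. A vanishing norm of \<Delta> would give x = 0 and then w =
  0.\<close>

lemma singular_perturbation_stretched:
  assumes C: "C \<in> carrier_mat (sum_list ns) (sum_list ns)" and n: "0 < sum_list ns"
    and \<Delta>: "\<Delta> \<in> block_diagonals ns" and det: "det (1\<^sub>m (sum_list ns) - C * \<Delta>) = 0"
  obtains x where "0 < max_singular_value \<Delta>" "blockwise_stretched ns C (1 / max_singular_value \<Delta>) x"
proof -
  let ?n = "sum_list ns"
  have D: "\<Delta> \<in> carrier_mat ?n ?n" using \<Delta> by (simp add: block_diagonals_iff)
  obtain w where w: "w \<in> carrier_vec ?n" "w \<noteq> 0\<^sub>v ?n" "C *\<^sub>v (\<Delta> *\<^sub>v w) = w"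
    using det unfolding det_one_minus_mult_eq_0_iff[OF C D] by blast
  define x where "x = \<Delta> *\<^sub>v w"
  have x: "x \<in> carrier_vec ?n" using D w by (simp add: x_def)
  have x0: "x \<noteq> 0\<^sub>v ?n"
  proof
    assume "x = 0\<^sub>v ?n"
    then have "C *\<^sub>v x = 0\<^sub>v ?n" using C by (auto simp: scalar_prod_def)
    then show False using w by (simp add: x_def)
  qed
  have le: "block_sqnorm ns j x \<le> (max_singular_value \<Delta>)\<^sup>2 * block_sqnorm ns j (C *\<^sub>v x)" for j
    using block_sqnorm_block_diagonal_le[OF \<Delta> n w(1)] w(3) by (simp add: x_def)
  have "max_singular_value \<Delta> \<noteq> 0"
  proof
    assume "max_singular_value \<Delta> = 0"
    then have "block_sqnorm ns j x = 0" for j using le[of j] block_sqnorm_nonneg[of ns j x] by simp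
    then have "x = 0\<^sub>v ?n" using x block_sqnorm_eq_0D by (intro eq_vecI) auto
    then show False using x0 by simp
  qed
  then have pos: "0 < max_singular_value \<Delta>" using max_singular_value_nonneg[OF D n] by simp
  have "blockwise_stretched ns C (1 / max_singular_value \<Delta>) x"
    unfolding blockwise_stretched_def using x x0 le pos by (simp add: power_divide field_simps)
  then show thesis using pos that by blast
qed

text \<open>With w = C x, the rank one block x_j w_j^* / |w_j|^2 maps w_j to x_j and has norm |x_j|
  / |w_j|, which is at most 1/c; hence C \<Delta> fixes w.\<close>

lemma stretched_singular_perturbation:
  assumes C: "C \<in> carrier_mat (sum_list ns) (sum_list ns)" and c: "0 < c"
    and x: "blockwise_stretched ns C c x"
  obtains \<Delta> where "\<Delta> \<in> block_diagonals ns" "det (1\<^sub>m (sum_list ns) - C * \<Delta>) = 0" "max_singular_value \<Delta> \<le> 1 / c"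
proof -
  let ?n = "sum_list ns"
  let ?b = "block_index ns"
  have xC: "x \<in> carrier_vec ?n" and x0: "x \<noteq> 0\<^sub>v ?n"
    and st: "\<And>j. j < length ns \<Longrightarrow> c\<^sup>2 * block_sqnorm ns j x \<le> block_sqnorm ns j (C *\<^sub>v x)"
    using x by (auto simp: blockwise_stretched_def)
  have n: "0 < ?n"
  proof -
    have "0 < m" if "x \<in> carrier_vec m" "x \<noteq> 0\<^sub>v m" for m
      using that by (auto simp: vec_eq_iff)
    then show ?thesis using xC x0 .
  qed
  define w where "w = C *\<^sub>v x"
  have w: "w \<in> carrier_vec ?n" using C xC by (simp add: w_def)
  define N where "N = (\<lambda>j. block_sqnorm ns j w)"
  \<comment> \<open>Where w_j = 0, division by zero makes the block 0. This is consistent: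
    stretching with \<open>c > 0\<close> then forces x_j = 0.\<close>
  define \<Delta> where "\<Delta> = Matrix.mat ?n ?n (\<lambda>(i, k). if ?b i = ?b k then x $ i * cnj (w $ k) / of_real (N (?b i)) else 0)"
  have \<Delta>: "\<Delta> \<in> block_diagonals ns" by (simp add: block_diagonals_iff \<Delta>_def)
  have D: "\<Delta> \<in> carrier_mat ?n ?n" by (simp add: \<Delta>_def)
  have \<Delta>v: "(\<Delta> *\<^sub>v v) $ i = x $ i / of_real (N (?b i)) * (\<Sum>k | k < ?n \<and> ?b k = ?b i. cnj (w $ k) * v $ k)"
    if v: "v \<in> carrier_vec ?n" and i: "i < ?n" for v i
  proof -
    have eq: "{..<?n} \<inter> {k. ?b i = ?b k} = {k. k < ?n \<and> ?b k = ?b i}" by auto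
    have "(\<Delta> *\<^sub>v v) $ i = (\<Sum>k<?n. if ?b i = ?b k then x $ i / of_real (N (?b i)) * (cnj (w $ k) * v $ k) else 0)"
      unfolding index_mult_mat_vec_sum[OF D v i] using i by (intro sum.cong) (auto simp: \<Delta>_def)
    also have "\<dots> = x $ i / of_real (N (?b i)) * (\<Sum>k | k < ?n \<and> ?b k = ?b i. cnj (w $ k) * v $ k)"
      by (simp add: sum.If_cases eq sum_distrib_left)
    finally show ?thesis .
  qed
  have xz: "x $ i = 0" if "i < ?n" "N (?b i) = 0" for i
  proof -
    have "c\<^sup>2 * block_sqnorm ns (?b i) x \<le> 0"
      using st[OF block_index_less[OF that(1)]] that(2) by (simp add: N_def w_def)
    then have "block_sqnorm ns (?b i) x = 0"
      using c block_sqnorm_nonneg[of ns "?b i" x] by (simp add: mult_le_0_iff)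
    then show ?thesis using that(1) by (rule block_sqnorm_eq_0D)
  qed
  have "\<Delta> *\<^sub>v w = x"
  proof (rule eq_vecI)
    fix i assume "i < dim_vec x"
    then have i: "i < ?n" using xC by simp
    have "(\<Sum>k | k < ?n \<and> ?b k = ?b i. cnj (w $ k) * w $ k) = of_real (N (?b i))"
      unfolding N_def block_sqnorm_def of_real_sum complex_norm_square by (simp add: mult.commute)
    then show "(\<Delta> *\<^sub>v w) $ i = x $ i" using \<Delta>v[OF w i] xz[OF i] by auto
  qed (use D xC in auto)
  then have "C *\<^sub>v (\<Delta> *\<^sub>v w) = w" by (simp add: w_def)
  moreover have "w \<noteq> 0\<^sub>v ?n"
  proof
    assume "w = 0\<^sub>v ?n"
    then have "\<Delta> *\<^sub>v w = 0\<^sub>v ?n" using D by (auto simp: scalar_prod_def)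
    then show False using \<open>\<Delta> *\<^sub>v w = x\<close> x0 by simp
  qed
  ultimately have det: "det (1\<^sub>m ?n - C * \<Delta>) = 0"
    unfolding det_one_minus_mult_eq_0_iff[OF C D] using w by blast
  have "max_singular_value \<Delta> \<le> 1 / c"
  proof (rule max_singular_value_le[OF D n])
    fix v :: "complex Matrix.vec" assume v: "v \<in> carrier_vec ?n"
    have "block_sqnorm ns j (\<Delta> *\<^sub>v v) \<le> (1 / c)\<^sup>2 * block_sqnorm ns j v" if j: "j < length ns" for j
    proof -
      let ?s = "\<Sum>k | k < ?n \<and> ?b k = j. cnj (w $ k) * v $ k"
      have "block_sqnorm ns j (\<Delta> *\<^sub>v v) = block_sqnorm ns j x * (cmod ?s)\<^sup>2 / (N j)\<^sup>2"
        unfolding block_sqnorm_def sum_distrib_right sum_divide_distrib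
        by (intro sum.cong) (auto simp: \<Delta>v[OF v] norm_mult norm_divide power_mult_distrib power_divide simp del: index_mult_mat_vec)
      also have "(cmod ?s)\<^sup>2 \<le> N j * block_sqnorm ns j v"
      proof -
        have "cmod ?s \<le> (\<Sum>k | k < ?n \<and> ?b k = j. cmod (w $ k) * cmod (v $ k))"
          by (rule order_trans[OF norm_sum]) (simp add: norm_mult)
        then have "(cmod ?s)\<^sup>2 \<le> (\<Sum>k | k < ?n \<and> ?b k = j. cmod (w $ k) * cmod (v $ k))\<^sup>2"
          by (intro power_mono) auto
        also have "\<dots> \<le> N j * block_sqnorm ns j v"
          unfolding N_def block_sqnorm_def by (rule Cauchy_Schwarz_ineq_sum)
        finally show ?thesis .
      qed
      then have "block_sqnorm ns j x * (cmod ?s)\<^sup>2 / (N j)\<^sup>2 \<le> block_sqnorm ns j x * (N j * block_sqnorm ns j v) / (N j)\<^sup>2"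
        by (intro divide_right_mono mult_left_mono) (auto simp: block_sqnorm_nonneg)
      also have "\<dots> = block_sqnorm ns j x / N j * block_sqnorm ns j v"
        by (simp add: power2_eq_square)
      also have "\<dots> \<le> (1 / c)\<^sup>2 * block_sqnorm ns j v"
      proof (rule mult_right_mono)
        show "block_sqnorm ns j x / N j \<le> (1 / c)\<^sup>2"
        proof (cases "N j = 0")
          case False
          then have "N j > 0" using block_sqnorm_nonneg[of ns j w] by (simp add: N_def)
          then show ?thesis using st[OF j] c by (simp add: N_def w_def power_divide field_simps)
        qed simp
      qed (rule block_sqnorm_nonneg)
      finally show ?thesis .
    qed
    then have "(\<Sum>j<length ns. block_sqnorm ns j (\<Delta> *\<^sub>v v)) \<le> (\<Sum>j<length ns. (1 / c)\<^sup>2 * block_sqnorm ns j v)"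
      by (intro sum_mono) simp
    then show "sqnorm_vec (\<Delta> *\<^sub>v v) \<le> (1 / c)\<^sup>2 * sqnorm_vec v"
      using D v by (simp add: sum_distrib_left[symmetric] sum_block_sqnorm)
  qed (use c in simp)
  then show thesis using that \<Delta> det by blast
qed

section \<open>Diagonal scalings and weighted norms\<close>

lemma index_mat_diag_mult_vec:
  "v \<in> carrier_vec n \<Longrightarrow> i < n \<Longrightarrow> (mat_diag n f *\<^sub>v v) $ i = f i * v $ i"
  using index_mult_mat_vec_sum[of "mat_diag n f" n n v i]
  by (simp add: mat_diag_def if_distrib[of "\<lambda>x. x * _"] cong: if_cong del: index_mult_mat_vec)

text \<open>The substitution y = D^(1/2) x removes the outer factors and turns Euclidean norms into
  norms weighted by the diagonal \<open>e\<close>.\<close>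

lemma le_scaled_max_singular_value_iff:
  assumes C: "C \<in> carrier_mat n n" and n: "0 < n" and c: "0 \<le> c" and e: "\<And>i. i < n \<Longrightarrow> 0 < e i"
  shows "c \<le> max_singular_value (map_mat complex_of_real (diag_powr (mat_diag n e) (1 / 2)) * C *
                  map_mat complex_of_real (diag_powr (mat_diag n e) (- 1 / 2))) \<longleftrightarrow>
    (\<exists>x\<in>carrier_vec n. x \<noteq> 0\<^sub>v n \<and> c\<^sup>2 * (\<Sum>i<n. e i * (cmod (x $ i))\<^sup>2) \<le> (\<Sum>i<n. e i * (cmod ((C *\<^sub>v x) $ i))\<^sup>2))"
proof -
  define S where "S = mat_diag n (\<lambda>i. complex_of_real (e i powr (1 / 2)))"
  define T where "T = mat_diag n (\<lambda>i. complex_of_real (e i powr (- 1 / 2)))"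
  have conv: "map_mat complex_of_real (diag_powr (mat_diag n e) p) = mat_diag n (\<lambda>i. complex_of_real (e i powr p))" for p
    by (rule eq_matI) (auto simp: diag_powr_def mat_diag_def)
  have ST: "S \<in> carrier_mat n n" "T \<in> carrier_mat n n" by (simp_all add: S_def T_def)
  have inv: "e i powr (1 / 2) * e i powr (- 1 / 2) = 1" if "i < n" for i
    using e[OF that] by (simp add: powr_add[symmetric])
  have sq: "(e i powr (1 / 2))\<^sup>2 = e i" if "i < n" for i
    using e[OF that] by (simp add: powr_half_sqrt)
  have "T * S = 1\<^sub>m n" "S * T = 1\<^sub>m n"
  proof -
    have "complex_of_real (e i powr (1 / 2)) * complex_of_real (e i powr (- 1 / 2)) = 1" if "i < n" for i
      using inv[OF that] by (metis of_real_mult of_real_1)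
    then show "T * S = 1\<^sub>m n" "S * T = 1\<^sub>m n"
      unfolding S_def T_def mat_diag_diag by (auto simp: mat_diag_def mult.commute intro!: eq_matI)
  qed
  then have TS: "T *\<^sub>v (S *\<^sub>v x) = x" "S *\<^sub>v (T *\<^sub>v x) = x" if "x \<in> carrier_vec n" for x
    using assoc_mult_mat_vec[OF ST(2,1) that] assoc_mult_mat_vec[OF ST that] that by simp_all
  have sqS: "sqnorm_vec (S *\<^sub>v v) = (\<Sum>i<n. e i * (cmod (v $ i))\<^sup>2)" if v: "v \<in> carrier_vec n" for v
  proof -
    have "dim_vec (S *\<^sub>v v) = n" using ST by simp
    then have "sqnorm_vec (S *\<^sub>v v) = (\<Sum>i<n. (cmod (complex_of_real (e i powr (1 / 2)) * v $ i))\<^sup>2)"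
      unfolding sqnorm_vec_def S_def by (simp add: index_mat_diag_mult_vec[OF v] del: index_mult_mat_vec)
    also have "\<dots> = (\<Sum>i<n. e i * (cmod (v $ i))\<^sup>2)"
      by (intro sum.cong refl) (simp add: norm_mult power_mult_distrib sq)
    finally show ?thesis .
  qed
  have SCT: "S * C * T \<in> carrier_mat n n" using ST C by simp
  have mul: "(S * C * T) *\<^sub>v v = S *\<^sub>v (C *\<^sub>v (T *\<^sub>v v))" if v: "v \<in> carrier_vec n" for v
  proof -
    have "(S * C * T) *\<^sub>v v = (S * C) *\<^sub>v (T *\<^sub>v v)"
      using ST C v by (intro assoc_mult_mat_vec[of _ n n _ n]) auto
    also have "\<dots> = S *\<^sub>v (C *\<^sub>v (T *\<^sub>v v))"
      using ST C v by (intro assoc_mult_mat_vec[of _ n n _ n]) auto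
    finally show ?thesis .
  qed
  show ?thesis
    unfolding conv S_def[symmetric] T_def[symmetric] le_max_singular_value_iff[OF SCT n c]
  proof
    assume "\<exists>x\<in>carrier_vec n. x \<noteq> 0\<^sub>v n \<and> c\<^sup>2 * sqnorm_vec x \<le> sqnorm_vec ((S * C * T) *\<^sub>v x)"
    then obtain y where y: "y \<in> carrier_vec n" "y \<noteq> 0\<^sub>v n" "c\<^sup>2 * sqnorm_vec y \<le> sqnorm_vec ((S * C * T) *\<^sub>v y)" by blast
    have x: "T *\<^sub>v y \<in> carrier_vec n" using ST y by auto
    have "T *\<^sub>v y \<noteq> 0\<^sub>v n"
    proof
      assume "T *\<^sub>v y = 0\<^sub>v n"
      then have "y = S *\<^sub>v 0\<^sub>v n" using TS(2)[OF y(1)] by simp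
      then show False using y(2) ST by (auto simp: scalar_prod_def)
    qed
    moreover have "c\<^sup>2 * sqnorm_vec (S *\<^sub>v (T *\<^sub>v y)) \<le> sqnorm_vec (S *\<^sub>v (C *\<^sub>v (T *\<^sub>v y)))"
      using y(3) unfolding mul[OF y(1)] TS(2)[OF y(1)] .
    then have "c\<^sup>2 * (\<Sum>i<n. e i * (cmod ((T *\<^sub>v y) $ i))\<^sup>2) \<le> (\<Sum>i<n. e i * (cmod ((C *\<^sub>v (T *\<^sub>v y)) $ i))\<^sup>2)"
      unfolding sqS[OF x] sqS[OF mult_mat_vec_carrier[OF C x]] .
    ultimately show "\<exists>x\<in>carrier_vec n. x \<noteq> 0\<^sub>v n \<and>
        c\<^sup>2 * (\<Sum>i<n. e i * (cmod (x $ i))\<^sup>2) \<le> (\<Sum>i<n. e i * (cmod ((C *\<^sub>v x) $ i))\<^sup>2)"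
      using x by blast
  next
    assume "\<exists>x\<in>carrier_vec n. x \<noteq> 0\<^sub>v n \<and>
        c\<^sup>2 * (\<Sum>i<n. e i * (cmod (x $ i))\<^sup>2) \<le> (\<Sum>i<n. e i * (cmod ((C *\<^sub>v x) $ i))\<^sup>2)"
    then obtain x where x: "x \<in> carrier_vec n" "x \<noteq> 0\<^sub>v n"
      "c\<^sup>2 * (\<Sum>i<n. e i * (cmod (x $ i))\<^sup>2) \<le> (\<Sum>i<n. e i * (cmod ((C *\<^sub>v x) $ i))\<^sup>2)" by blast
    have y: "S *\<^sub>v x \<in> carrier_vec n" using ST x by auto
    have "S *\<^sub>v x \<noteq> 0\<^sub>v n"
    proof
      assume "S *\<^sub>v x = 0\<^sub>v n"
      then have "x = T *\<^sub>v 0\<^sub>v n" using TS(1)[OF x(1)] by simp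
      then show False using x(2) ST by (auto simp: scalar_prod_def)
    qed
    moreover have "c\<^sup>2 * sqnorm_vec (S *\<^sub>v x) \<le> sqnorm_vec ((S * C * T) *\<^sub>v (S *\<^sub>v x))"
      using x(3) unfolding mul[OF y] TS(1)[OF x(1)] sqS[OF x(1)] sqS[OF mult_mat_vec_carrier[OF C x(1)]] .
    ultimately show "\<exists>x\<in>carrier_vec n. x \<noteq> 0\<^sub>v n \<and> c\<^sup>2 * sqnorm_vec x \<le> sqnorm_vec ((S * C * T) *\<^sub>v x)"
      using y by blast
  qed
qed

section \<open>From all scalings to one complex vector\<close>

lemma qform_sum_squares:
  "qform n (\<lambda>i k. \<Sum>l\<in>L. a l i * a l k - c * (g l i * g l k)) f =
    (\<Sum>l\<in>L. (\<Sum>i<n. a l i * f i)\<^sup>2 - c * (\<Sum>i<n. g l i * f i)\<^sup>2)"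
proof -
  have "(\<Sum>l\<in>L. (\<Sum>i<n. a l i * f i)\<^sup>2 - c * (\<Sum>i<n. g l i * f i)\<^sup>2) =
      (\<Sum>l\<in>L. \<Sum>i<n. \<Sum>k<n. (a l i * a l k - c * (g l i * g l k)) * f i * f k)"
    by (intro sum.cong refl)
       (simp add: power2_eq_square sum_product sum_distrib_left sum_subtractf[symmetric] algebra_simps)
  also have "\<dots> = (\<Sum>i<n. \<Sum>l\<in>L. \<Sum>k<n. (a l i * a l k - c * (g l i * g l k)) * f i * f k)"
    by (rule sum.swap)
  also have "\<dots> = (\<Sum>i<n. \<Sum>k<n. \<Sum>l\<in>L. (a l i * a l k - c * (g l i * g l k)) * f i * f k)"
    by (intro sum.cong refl sum.swap)
  finally show ?thesis by (simp add: qform_def sum_distrib_right)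
qed

text \<open>The only place where \<open>M\<close> being real and the bound of five blocks enter: the
  two real vectors found for the block forms become the real and imaginary parts of the
  witness.\<close>

lemma stretched_if_scaled_stretched:
  fixes M :: "real mat"
  assumes M: "M \<in> carrier_mat (sum_list ns) (sum_list ns)" and n: "0 < sum_list ns" and len: "length ns \<le> 5"
    and hyp: "\<And>ds. length ds = length ns \<Longrightarrow> \<forall>d\<in>set ds. 0 < d \<Longrightarrow>
      \<exists>x\<in>carrier_vec (sum_list ns). x \<noteq> 0\<^sub>v (sum_list ns) \<and>
        c\<^sup>2 * (\<Sum>i<sum_list ns. ds ! block_index ns i * (cmod (x $ i))\<^sup>2)
          \<le> (\<Sum>i<sum_list ns. ds ! block_index ns i * (cmod ((map_mat complex_of_real M *\<^sub>v x) $ i))\<^sup>2)"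
  obtains x where "blockwise_stretched ns (map_mat complex_of_real M) c x"
proof -
  let ?n = "sum_list ns"
  let ?b = "block_index ns"
  let ?C = "map_mat complex_of_real M"
  have C: "?C \<in> carrier_mat ?n ?n" using M by simp
  have b5: "?b l < 5" if "l < ?n" for l using block_index_less[OF that] len by simp
  \<comment> \<open>Five dimensions serve every admissible number of blocks: \<open>h\<close> gives
    each block its own basis vector, and basis vectors left over carry the zero form.\<close>
  define B where "B = (Basis :: (real \<times> real \<times> real \<times> real \<times> real) set)"
  have card: "card B = 5" by (simp add: B_def)
  obtain h where h: "bij_betw h {0..<5::nat} B"
    using ex_bij_betw_nat_finite[of B] unfolding card by (auto simp: B_def)
  have hB: "h (?b l) \<in> B" if "l < ?n" for l using h b5[OF that] by (auto simp: bij_betw_def)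
  \<comment> \<open>For \<beta> = h j this is M^T P_j M - c^2 P_j, summed over the rows
    \<open>l\<close> of block \<open>j\<close>; \<open>X f l\<close> is the contribution of row
    \<open>l\<close>.\<close>
  define A where "A = (\<lambda>\<beta> i k. \<Sum>l | l < ?n \<and> h (?b l) = \<beta>. M $$ (l, i) * M $$ (l, k) - c\<^sup>2 * (delta l i * delta l k))"
  define X where "X = (\<lambda>f l. (\<Sum>i<?n. M $$ (l, i) * f i)\<^sup>2 - c\<^sup>2 * (f l)\<^sup>2)"
  have qA: "qform ?n (A \<beta>) f = (\<Sum>l | l < ?n \<and> h (?b l) = \<beta>. X f l)" for \<beta> f
    unfolding A_def qform_sum_squares X_def
    by (intro sum.cong refl) (auto simp: delta_def if_distrib[of "\<lambda>x. x * _"] cong: if_cong)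
  have Cv: "(?C *\<^sub>v v) $ l = Complex (\<Sum>i<?n. M $$ (l, i) * Re (v $ i)) (\<Sum>i<?n. M $$ (l, i) * Im (v $ i))"
    if v: "v \<in> carrier_vec ?n" and l: "l < ?n" for v l
    unfolding index_mult_mat_vec_sum[OF C v l] using M l by (simp add: complex_eq_iff)
  have XX: "(cmod ((?C *\<^sub>v v) $ l))\<^sup>2 - c\<^sup>2 * (cmod (v $ l))\<^sup>2 = X (\<lambda>i. Re (v $ i)) l + X (\<lambda>i. Im (v $ i)) l"
    if v: "v \<in> carrier_vec ?n" and l: "l < ?n" for v l
    unfolding Cv[OF v l] by (simp add: X_def cmod_power2 algebra_simps)
  have "\<exists>f g. 0 < qform ?n delta f + qform ?n delta g \<and> (\<forall>\<beta>\<in>B. 0 \<le> qform ?n (A \<beta>) f + qform ?n (A \<beta>) g)"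
    unfolding B_def
  proof (rule two_vectors_suffice)
    fix d :: "real \<times> real \<times> real \<times> real \<times> real \<Rightarrow> real"
    assume d: "\<forall>b\<in>Basis. 0 < d b"
    define ds where "ds = map (\<lambda>j. d (h j)) [0..<length ns]"
    have "0 < d (h j)" if "j < length ns" for j
      using d h that len by (auto simp: bij_betw_def B_def)
    then obtain x where x: "x \<in> carrier_vec ?n" "x \<noteq> 0\<^sub>v ?n" and le: "c\<^sup>2 * (\<Sum>i<?n. ds ! ?b i * (cmod (x $ i))\<^sup>2)
        \<le> (\<Sum>i<?n. ds ! ?b i * (cmod ((?C *\<^sub>v x) $ i))\<^sup>2)"
      using hyp[of ds] by (auto simp: ds_def)
    define Y where "Y = (\<lambda>f. \<Sum>\<beta>\<in>B. d \<beta> * qform ?n (A \<beta>) f)"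
    have Y: "Y f = (\<Sum>l<?n. ds ! ?b l * X f l)" for f
    proof -
      have "Y f = (\<Sum>\<beta>\<in>B. \<Sum>l | l \<in> {..<?n} \<and> h (?b l) = \<beta>. d (h (?b l)) * X f l)"
        unfolding Y_def qA sum_distrib_left by (intro sum.cong refl) auto
      also have "\<dots> = (\<Sum>l<?n. d (h (?b l)) * X f l)"
        using hB by (intro sum.group) (auto simp: B_def)
      also have "\<dots> = (\<Sum>l<?n. ds ! ?b l * X f l)"
        by (intro sum.cong refl) (simp add: ds_def block_index_less)
      finally show ?thesis .
    qed
    \<comment> \<open>Ensures that a nonzero one among the real and imaginary parts of
      \<open>x\<close> has nonnegative \<open>Y\<close>: a part that vanishes contributes nothing to
      the sum.\<close>
    have Y0: "Y f = 0" if "qform ?n delta f = 0" for f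
      using that unfolding Y by (intro sum.neutral) (auto simp: X_def qform_delta_zero_iff)
    let ?f = "\<lambda>i. Re (x $ i)" and ?g = "\<lambda>i. Im (x $ i)"
    have "Y ?f + Y ?g = (\<Sum>l<?n. ds ! ?b l * ((cmod ((?C *\<^sub>v x) $ l))\<^sup>2 - c\<^sup>2 * (cmod (x $ l))\<^sup>2))"
      unfolding Y sum.distrib[symmetric] by (intro sum.cong refl) (simp add: XX[OF x(1)] distrib_left del: index_mult_mat_vec)
    also have "\<dots> \<ge> 0"
      using le by (simp add: right_diff_distrib sum_subtractf sum_distrib_left mult_ac del: index_mult_mat_vec)
    finally have YY: "0 \<le> Y ?f + Y ?g" .
    have "\<not> (qform ?n delta ?f = 0 \<and> qform ?n delta ?g = 0)"
    proof
      assume "qform ?n delta ?f = 0 \<and> qform ?n delta ?g = 0"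
      then have "x = 0\<^sub>v ?n" using x(1) by (intro eq_vecI) (auto simp: qform_delta_zero_iff complex_eq_iff)
      then show False using x(2) by simp
    qed
    then have "0 < qform ?n delta ?f \<and> 0 \<le> Y ?f \<or> 0 < qform ?n delta ?g \<and> 0 \<le> Y ?g"
      using YY Y0[of ?f] Y0[of ?g] qform_delta_nonneg[of ?n ?f] qform_delta_nonneg[of ?n ?g] by linarith
    then show "\<exists>f. 0 < qform ?n delta f \<and> 0 \<le> (\<Sum>b\<in>Basis. d b * qform ?n (A b) f)"
      unfolding Y_def B_def by blast
  qed (use n in auto)
  then obtain f g where fg: "0 < qform ?n delta f + qform ?n delta g"
    and nonneg: "\<And>\<beta>. \<beta> \<in> B \<Longrightarrow> 0 \<le> qform ?n (A \<beta>) f + qform ?n (A \<beta>) g" by blast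
  define x where "x = Matrix.vec ?n (\<lambda>i. Complex (f i) (g i))"
  have x: "x \<in> carrier_vec ?n" by (simp add: x_def)
  have "x \<noteq> 0\<^sub>v ?n"
  proof
    assume "x = 0\<^sub>v ?n"
    then have "x $ i = 0" if "i < ?n" for i using that by simp
    then have "f i = 0 \<and> g i = 0" if "i < ?n" for i using that by (auto simp: x_def complex_eq_iff)
    then have "qform ?n delta f = 0" "qform ?n delta g = 0" by (simp_all add: qform_delta_zero_iff)
    then show False using fg by simp
  qed
  moreover have "c\<^sup>2 * block_sqnorm ns j x \<le> block_sqnorm ns j (?C *\<^sub>v x)" if j: "j < length ns" for j
  proof -
    have L: "{l. l < ?n \<and> h (?b l) = h j} = {l. l < ?n \<and> ?b l = j}"
      using h b5 j len by (auto simp: bij_betw_def inj_on_def)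
    have Xcong: "X (\<lambda>i. Re (x $ i)) l = X f l" "X (\<lambda>i. Im (x $ i)) l = X g l" if "l < ?n" for l
      using that by (simp_all add: X_def x_def)
    have "h j \<in> B" using h j len by (auto simp: bij_betw_def)
    then have "0 \<le> (\<Sum>l | l < ?n \<and> ?b l = j. X f l + X g l)"
      using nonneg[of "h j"] unfolding qA L sum.distrib by blast
    also have "\<dots> = (\<Sum>l | l < ?n \<and> ?b l = j. (cmod ((?C *\<^sub>v x) $ l))\<^sup>2 - c\<^sup>2 * (cmod (x $ l))\<^sup>2)"
      by (intro sum.cong refl) (simp add: XX[OF x] Xcong del: index_mult_mat_vec)
    also have "\<dots> = block_sqnorm ns j (?C *\<^sub>v x) - c\<^sup>2 * block_sqnorm ns j x"
      by (simp add: block_sqnorm_def sum_subtractf sum_distrib_left del: index_mult_mat_vec)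
    finally show ?thesis by simp
  qed
  ultimately show thesis using x that unfolding blockwise_stretched_def by blast
qed

section \<open>The upper bound as a condition on all scalings\<close>

lemma block_scalings_eq:
  "block_scalings ns = {mat_diag (sum_list ns) (\<lambda>i. ds ! block_index ns i) | ds.
      length ds = length ns \<and> (\<forall>d\<in>set ds. 0 < d)}"
  unfolding block_scalings_def by (metis (no_types, lifting) diag_block_mat_scalars)

text \<open>A number is below an infimum exactly when it is below every value, so each scaling is
  treated separately, whether or not the infimum is attained. The identity scaling and the lower
  bound 0 make the infimum meaningful.\<close>

lemma le_convex_upper_bound_iff:
  assumes C: "C \<in> carrier_mat (sum_list ns) (sum_list ns)" and n: "0 < sum_list ns" and c: "0 \<le> c"
  shows "c \<le> convex_upper_bound ns C \<longleftrightarrow>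
    (\<forall>ds. length ds = length ns \<and> (\<forall>d\<in>set ds. 0 < d) \<longrightarrow>
      (\<exists>x\<in>carrier_vec (sum_list ns). x \<noteq> 0\<^sub>v (sum_list ns) \<and>
        c\<^sup>2 * (\<Sum>i<sum_list ns. ds ! block_index ns i * (cmod (x $ i))\<^sup>2)
          \<le> (\<Sum>i<sum_list ns. ds ! block_index ns i * (cmod ((C *\<^sub>v x) $ i))\<^sup>2)))"
proof -
  let ?V = "\<lambda>D. max_singular_value (map_mat complex_of_real (diag_powr D (1 / 2)) * C *
                            map_mat complex_of_real (diag_powr D (- 1 / 2)))"
  have carrier: "map_mat complex_of_real (diag_powr D (1 / 2)) * C * map_mat complex_of_real (diag_powr D (- 1 / 2))
      \<in> carrier_mat (sum_list ns) (sum_list ns)" if "D \<in> block_scalings ns" for D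
    using that C by (auto simp: block_scalings_eq diag_powr_def mat_diag_def)
  have "mat_diag (sum_list ns) (\<lambda>i. replicate (length ns) 1 ! block_index ns i) \<in> block_scalings ns"
    unfolding block_scalings_eq by (intro CollectI exI[of _ "replicate (length ns) 1"]) simp
  then have ne: "block_scalings ns \<noteq> {}" by blast
  have bdd: "bdd_below (?V ` block_scalings ns)"
    using max_singular_value_nonneg[OF carrier n] by (intro bdd_belowI[of _ 0]) auto
  have "c \<le> convex_upper_bound ns C \<longleftrightarrow> (\<forall>D\<in>block_scalings ns. c \<le> ?V D)"
    unfolding convex_upper_bound_def using le_cINF_iff[OF ne bdd] by blast
  also have "\<dots> \<longleftrightarrow> (\<forall>ds. length ds = length ns \<and> (\<forall>d\<in>set ds. 0 < d) \<longrightarrow>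
      c \<le> ?V (mat_diag (sum_list ns) (\<lambda>i. ds ! block_index ns i)))"
    unfolding block_scalings_eq by blast
  finally show ?thesis
    using le_scaled_max_singular_value_iff[OF C n c, of "\<lambda>i. _ ! block_index ns i"] block_index_less[of _ ns]
    by (simp del: index_mult_mat_vec)
qed

text \<open>The blockwise inequalities, weighted by the positive d_j and added, show that one
  \<open>x\<close> is a witness for all scalings.\<close>

lemma stretched_le_convex_upper_bound:
  assumes C: "C \<in> carrier_mat (sum_list ns) (sum_list ns)" and n: "0 < sum_list ns" and c: "0 \<le> c"
    and x: "blockwise_stretched ns C c x"
  shows "c \<le> convex_upper_bound ns C"
  unfolding le_convex_upper_bound_iff[OF C n c]
proof (intro allI impI bexI conjI)
  fix ds :: "real list" assume ds: "length ds = length ns \<and> (\<forall>d\<in>set ds. 0 < d)"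
  have W: "(\<Sum>i<sum_list ns. ds ! block_index ns i * (cmod (v $ i))\<^sup>2) = (\<Sum>j<length ns. ds ! j * block_sqnorm ns j v)" for v
    unfolding sum_blocks[symmetric, of _ ns] block_sqnorm_def sum_distrib_left
    by (intro sum.cong refl) auto
  have "(\<Sum>j<length ns. ds ! j * (c\<^sup>2 * block_sqnorm ns j x)) \<le> (\<Sum>j<length ns. ds ! j * block_sqnorm ns j (C *\<^sub>v x))"
    using x ds by (intro sum_mono mult_left_mono) (auto simp: blockwise_stretched_def intro: less_imp_le)
  then show "c\<^sup>2 * (\<Sum>i<sum_list ns. ds ! block_index ns i * (cmod (x $ i))\<^sup>2)
      \<le> (\<Sum>i<sum_list ns. ds ! block_index ns i * (cmod ((C *\<^sub>v x) $ i))\<^sup>2)"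
    unfolding W sum_distrib_left by (simp add: mult_ac)
qed (use x in \<open>auto simp: blockwise_stretched_def\<close>)

section \<open>Equality of the structured singular value and its upper bound\<close>

theorem theorem4:
  fixes ns :: "nat list" and n :: nat and M :: "real mat"
  assumes "ns \<noteq> []"
    and "\<forall>k\<in>set ns. 0 < k"
    and "sum_list ns = n"
    and "M \<in> carrier_mat n n"
    and "length ns \<le> 5"
  shows "structured_singular_value (block_diagonals ns) (map_mat complex_of_real M) =
         convex_upper_bound ns (map_mat complex_of_real M)"
proof -
  let ?C = "map_mat complex_of_real M"
  let ?\<nu> = "convex_upper_bound ns ?C"
  have M: "M \<in> carrier_mat (sum_list ns) (sum_list ns)" using assms by simp
  have C: "?C \<in> carrier_mat (sum_list ns) (sum_list ns)" using M by simp
  have dim: "dim_row M = sum_list ns" using M by auto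
  have n: "0 < sum_list ns" using assms(1,2) by (cases ns) auto
  \<comment> \<open>At level 0 any nonzero vector is a witness; the first unit vector is
    used.\<close>
  have \<nu>0: "0 \<le> ?\<nu>"
    using n by (subst le_convex_upper_bound_iff[OF C n]) (auto intro!: bexI[of _ "unit_vec (sum_list ns) 0"] sum_nonneg mult_nonneg_nonneg intro: less_imp_le simp: block_index_less simp del: index_mult_mat_vec)
  \<comment> \<open>The characterisation of lower bounds, taken at the bound itself, supplies the
    hypothesis for every scaling and so yields G(\<nu>).\<close>
  obtain x where x: "blockwise_stretched ns ?C ?\<nu> x"
    using le_convex_upper_bound_iff[OF C n \<nu>0] stretched_if_scaled_stretched[OF M n assms(5), of ?\<nu>] by blast
  show ?thesis
  proof (cases "\<exists>\<Delta>\<in>block_diagonals ns. det (1\<^sub>m (sum_list ns) - ?C * \<Delta>) = 0")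
    case False
    have "?\<nu> = 0"
    proof (rule ccontr)
      assume "?\<nu> \<noteq> 0"
      then have "0 < ?\<nu>" using \<nu>0 by simp
      then show False using stretched_singular_perturbation[OF C _ x] False by blast
    qed
    then show ?thesis using False by (auto simp: structured_singular_value_def dim)
  next
    case True
    have lower: "0 < max_singular_value \<Delta> \<and> 1 / max_singular_value \<Delta> \<le> ?\<nu>"
      if \<Delta>: "\<Delta> \<in> block_diagonals ns" "det (1\<^sub>m (sum_list ns) - ?C * \<Delta>) = 0" for \<Delta>
    proof -
      obtain y where "0 < max_singular_value \<Delta>" "blockwise_stretched ns ?C (1 / max_singular_value \<Delta>) y"
        using singular_perturbation_stretched[OF C n \<Delta>] by blast
      then show ?thesis using stretched_le_convex_upper_bound[OF C n] by simp
    qed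
    have pos: "0 < ?\<nu>"
      using True lower by (metis less_le_trans zero_less_divide_1_iff)
    \<comment> \<open>The perturbation built from \<open>x\<close> attains the lower bound
      \<open>1 / ?\<nu>\<close> valid for all singular perturbations, so the minimum exists and
      \<open>LEAST\<close> denotes it.\<close>
    obtain \<Delta> where \<Delta>: "\<Delta> \<in> block_diagonals ns" "det (1\<^sub>m (sum_list ns) - ?C * \<Delta>) = 0" "max_singular_value \<Delta> \<le> 1 / ?\<nu>"
      using stretched_singular_perturbation[OF C pos x] by blast
    have ge: "1 / ?\<nu> \<le> max_singular_value \<Delta>'"
      if "\<Delta>' \<in> block_diagonals ns" "det (1\<^sub>m (sum_list ns) - ?C * \<Delta>') = 0" for \<Delta>'
      using conjunct1[OF lower[OF that]] conjunct2[OF lower[OF that]] pos by (simp add: field_simps)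
    have "max_singular_value \<Delta> = 1 / ?\<nu>" using ge[OF \<Delta>(1,2)] \<Delta>(3) by simp
    then have "(LEAST r. r \<in> {max_singular_value \<Delta> | \<Delta>.
        \<Delta> \<in> block_diagonals ns \<and> det (1\<^sub>m (sum_list ns) - ?C * \<Delta>) = 0}) = 1 / ?\<nu>"
      using \<Delta> ge by (intro Least_equality) (auto intro!: exI[of _ \<Delta>])
    then show ?thesis using True by (auto simp: structured_singular_value_def dim)
  qed
qed

end
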